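(* Let $K$ be a field, $S=K[x_1,\dots,x_n]$, let $k\geq 0$ be an integer, and let $M$ be a finitely generated $\mathbb{Z}^n$-graded $S$-module which is the $k$-th syzygy module in a minimal $\mathbb{Z}^n$-graded free resolution. If $\beta_p^{lin}(M)\neq 0$ for some $p\in\mathbb{N}$, then $$\beta_i^{lin}(M)\geq\binom{p+k}{i+k}\quad\text{for } i=0,\dots,p.$$
   Context: $\mathbb{N}=\{0,1,2,\dots\}$. $S$ is $\mathbb{Z}^n$-graded by $\deg(x_i)=\epsilon_i$, the $i$-th standard basis vector of $\mathbb{Z}^n$. A $\mathbb{Z}^n$-graded module $M$ is regarded as $\mathbb{Z}$-graded via $M_i=\bigoplus_{a\in\mathbb{Z}^n,\,|a|=i}M_a$, where $|a|=a_1+\dots+a_n$. With respect to this $\mathbb{Z}$-grading, $\beta_{i,i+j}(M)=\dim_K\operatorname{Tor}^S_i(M,K)_{i+j}$, and if $d$ is the initial degree of $M$ ($M_i=0$ for $i<d$, $M_d\neq0$), then $\beta_i^{lin}(M)=\beta_{i,i+d}(M)$. "$M$ is the $k$-th syzygy module in a minimal $\mathbb{Z}^n$-graded free resolution" means that there is a finitely generated $\mathbb{Z}^n$-graded $S$-module $N$ with minimal $\mathbb{Z}^n$-graded free resolution $\cdots\to F_1\to F_0\to N\to 0$ such that $M\cong\Omega_k(N)$ as $\mathbb{Z}^n$-graded modules, where $\Omega_0(N)=N$ and $\Omega_k(N)=\operatorname{Im}(F_k\to F_{k-1})$ for $k\geq1$. *)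

theory Defs
  imports Complex_Main "HOL-Library.Poly_Mapping"
begin

section \<open>The polynomial ring and its $Z^n$-grading\<close>

text \<open>
  The variables are indexed by a finite type \<open>'n\<close>, so \<open>n = CARD('n)\<close>. A polynomial maps exponent
  vectors to coefficients, and the ring multiplication is the convolution product of
  \<^theory>\<open>HOL-Library.Poly_Mapping\<close>. Elements of $Z^n$ are functions \<open>'n \<Rightarrow> int\<close>.
\<close>

type_synonym ('n, 'k) mpoly = "('n \<Rightarrow>\<^sub>0 nat) \<Rightarrow>\<^sub>0 'k"

definition const :: "'k::zero \<Rightarrow> ('n, 'k) mpoly" where
  "const c = Poly_Mapping.single 0 c"

definition shift :: "('n \<Rightarrow>\<^sub>0 nat) \<Rightarrow> ('n \<Rightarrow> int) \<Rightarrow> 'n \<Rightarrow> int" where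
  "shift t a = (\<lambda>l. int (Poly_Mapping.lookup t l) + a l)"

definition total :: "('n::finite \<Rightarrow> int) \<Rightarrow> int" where
  "total a = (\<Sum>l\<in>UNIV. a l)"

definition irrelevant_ideal :: "('n, 'k::zero) mpoly set" where
  "irrelevant_ideal = {q. Poly_Mapping.lookup q 0 = 0}"


section \<open>Graded modules\<close>

text \<open>
  \<open>scale\<close> is the module structure on the whole type \<open>'m\<close>, and \<open>gr a\<close> is the component of degree \<open>a\<close>.
  The component of \<open>S\<close> in the degree of an exponent vector \<open>t\<close> consists of the terms
  \<open>single t c\<close>, and the components in degrees outside $N^n$ vanish; so \<open>gr_scale\<close> says
  \<open>S\<^sub>b M\<^sub>a \<subseteq> M\<^sub>a\<^sub>+\<^sub>b\<close>. The axiom \<open>gr_direct\<close> says that the module is the direct sum of its components.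
\<close>

locale zn_graded_module = module scale
  for scale :: "('n::finite, 'k::field) mpoly \<Rightarrow> 'm::ab_group_add \<Rightarrow> 'm" +
  fixes gr :: "('n \<Rightarrow> int) \<Rightarrow> 'm set"
  assumes gr_zero: "0 \<in> gr a"
    and gr_add: "x \<in> gr a \<Longrightarrow> y \<in> gr a \<Longrightarrow> x + y \<in> gr a"
    and gr_scale: "x \<in> gr a \<Longrightarrow> scale (Poly_Mapping.single t c) x \<in> gr (shift t a)"
    and gr_direct: "\<exists>!f. (\<forall>a. Poly_Mapping.lookup f a \<in> gr a) \<and>
                       x = (\<Sum>a\<in>Poly_Mapping.keys f. Poly_Mapping.lookup f a)"

definition finitely_generated ::
    "(('n, 'k::field) mpoly \<Rightarrow> 'm::ab_group_add \<Rightarrow> 'm) \<Rightarrow> bool" where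
  "finitely_generated scale \<longleftrightarrow> (\<exists>A. finite A \<and> module.span scale A = UNIV)"

text \<open>The component of degree \<open>j\<close> of the induced $Z$-grading.\<close>

definition coarse :: "(('n::finite \<Rightarrow> int) \<Rightarrow> 'm::ab_group_add set) \<Rightarrow> int \<Rightarrow> 'm set" where
  "coarse gr j = {(\<Sum>a\<in>Poly_Mapping.keys f. Poly_Mapping.lookup f a) | f.
     (\<forall>a. Poly_Mapping.lookup f a \<in> gr a) \<and> (\<forall>a\<in>Poly_Mapping.keys f. total a = j)}"

text \<open>Well defined for nonzero finitely generated modules.\<close>

definition initial_degree :: "(('n::finite \<Rightarrow> int) \<Rightarrow> 'm::ab_group_add set) \<Rightarrow> int" where
  "initial_degree gr = (THE d. (\<forall>i<d. coarse gr i = {0}) \<and> coarse gr d \<noteq> {0})"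

text \<open>
  An isomorphism of graded modules from the module given by \<open>s1\<close> and \<open>gr1\<close> onto the graded submodule
  \<open>X\<close> of the module given by \<open>s2\<close>, where \<open>X\<close> has the components \<open>X \<inter> gr2 a\<close>.
\<close>

definition graded_iso_onto ::
    "(('n, 'k::field) mpoly \<Rightarrow> 'm::ab_group_add \<Rightarrow> 'm) \<Rightarrow> (('n \<Rightarrow> int) \<Rightarrow> 'm set) \<Rightarrow>
     (('n, 'k) mpoly \<Rightarrow> 'b::ab_group_add \<Rightarrow> 'b) \<Rightarrow> 'b set \<Rightarrow> (('n \<Rightarrow> int) \<Rightarrow> 'b set) \<Rightarrow> bool" where
  "graded_iso_onto s1 gr1 s2 X gr2 \<longleftrightarrow>
     (\<exists>\<phi>. module_hom s1 s2 \<phi> \<and> bij_betw \<phi> UNIV X \<and> (\<forall>a. \<phi> ` gr1 a = X \<inter> gr2 a))"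


section \<open>Graded free modules of finite rank\<close>

text \<open>
  A list \<open>D\<close> of degrees stands for the free module $\bigoplus_b S(-D_b)$ whose basis element \<open>b\<close> has
  degree \<open>D ! b\<close>. It is realized inside the free module on the index set \<open>nat\<close>, whose elements map
  indices to coefficients.
\<close>

type_synonym ('n, 'k) fvec = "nat \<Rightarrow>\<^sub>0 ('n, 'k) mpoly"

definition fscale :: "('n, 'k::field) mpoly \<Rightarrow> ('n, 'k) fvec \<Rightarrow> ('n, 'k) fvec" where
  "fscale q = Poly_Mapping.map (\<lambda>r. q * r)"

definition free_mod :: "('n \<Rightarrow> int) list \<Rightarrow> ('n, 'k::field) fvec set" where
  "free_mod D = {v. Poly_Mapping.keys v \<subseteq> {..<length D}}"

definition free_gr :: "('n \<Rightarrow> int) list \<Rightarrow> ('n \<Rightarrow> int) \<Rightarrow> ('n, 'k::field) fvec set" where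
  "free_gr D a = {v \<in> free_mod D. \<forall>b < length D. \<forall>t \<in> Poly_Mapping.keys (Poly_Mapping.lookup v b).
                    shift t (D ! b) = a}"

definition irrelevant_free :: "('n \<Rightarrow> int) list \<Rightarrow> ('n, 'k::field) fvec set" where
  "irrelevant_free D = module.span fscale {fscale q v | q v. q \<in> irrelevant_ideal \<and> v \<in> free_mod D}"

lemma lookup_fscale: "Poly_Mapping.lookup (fscale q v) b = q * Poly_Mapping.lookup v b"
  unfolding fscale_def by (transfer fixing: q) (auto simp: when_def)

lemma module_fscale: "module fscale"
  by unfold_locales
    (rule poly_mapping_eqI, simp add: lookup_fscale lookup_add algebra_simps)+

lemma vector_space_fscale_const: "vector_space (\<lambda>c::'k::field. fscale (const c :: ('n, 'k) mpoly))"
proof -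
  interpret module "fscale :: ('n, 'k) mpoly \<Rightarrow> _" by (rule module_fscale)
  show ?thesis
    by unfold_locales
      (simp_all add: const_def scale_right_distrib single_add scale_left_distrib mult_single)
qed


section \<open>Free resolutions and syzygies\<close>

text \<open>
  \<open>D i\<close> gives the free module $F_i$, \<open>d i\<close> is the differential $F_{i+1} \to F_i$ and \<open>e\<close> is the
  augmentation $F_0 \to M$. A homomorphism on $F_i$ is given by a homomorphism on the whole ambient
  free module, of which only the restriction to $F_i$ matters.
\<close>

definition graded_free_resolution ::
    "(('n, 'k::field) mpoly \<Rightarrow> 'm::ab_group_add \<Rightarrow> 'm) \<Rightarrow> (('n \<Rightarrow> int) \<Rightarrow> 'm set) \<Rightarrow>
     (nat \<Rightarrow> ('n \<Rightarrow> int) list) \<Rightarrow> (nat \<Rightarrow> ('n, 'k) fvec \<Rightarrow> ('n, 'k) fvec) \<Rightarrow> (('n, 'k) fvec \<Rightarrow> 'm) \<Rightarrow> bool"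
  where
  "graded_free_resolution scale gr D d e \<longleftrightarrow>
     module_hom fscale scale e \<and>
     (\<forall>a. e ` free_gr (D 0) a \<subseteq> gr a) \<and>
     (\<forall>i. module_hom fscale fscale (d i)) \<and>
     (\<forall>i a. d i ` free_gr (D (Suc i)) a \<subseteq> free_gr (D i) a) \<and>
     e ` free_mod (D 0) = UNIV \<and>
     d 0 ` free_mod (D (Suc 0)) = {v \<in> free_mod (D 0). e v = 0} \<and>
     (\<forall>i. d (Suc i) ` free_mod (D (Suc (Suc i))) = {v \<in> free_mod (D (Suc i)). d i v = 0})"

definition minimal_graded_free_resolution ::
    "(('n, 'k::field) mpoly \<Rightarrow> 'm::ab_group_add \<Rightarrow> 'm) \<Rightarrow> (('n \<Rightarrow> int) \<Rightarrow> 'm set) \<Rightarrow>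
     (nat \<Rightarrow> ('n \<Rightarrow> int) list) \<Rightarrow> (nat \<Rightarrow> ('n, 'k) fvec \<Rightarrow> ('n, 'k) fvec) \<Rightarrow> (('n, 'k) fvec \<Rightarrow> 'm) \<Rightarrow> bool"
  where
  "minimal_graded_free_resolution scale gr D d e \<longleftrightarrow>
     graded_free_resolution scale gr D d e \<and>
     (\<forall>i. d i ` free_mod (D (Suc i)) \<subseteq> irrelevant_free (D i))"

text \<open>The module \<open>M\<close> is isomorphic to the \<open>k\<close>-th syzygy module of \<open>N\<close>.\<close>

definition is_syzygy_of ::
    "nat \<Rightarrow> (('n, 'k::field) mpoly \<Rightarrow> 'm::ab_group_add \<Rightarrow> 'm) \<Rightarrow> (('n \<Rightarrow> int) \<Rightarrow> 'm set) \<Rightarrow>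
     (('n, 'k) mpoly \<Rightarrow> 'b::ab_group_add \<Rightarrow> 'b) \<Rightarrow> (('n \<Rightarrow> int) \<Rightarrow> 'b set) \<Rightarrow> bool" where
  "is_syzygy_of k scaleM grM scaleN grN \<longleftrightarrow>
     (\<exists>D d e. minimal_graded_free_resolution scaleN grN D d e \<and>
        (case k of
           0 \<Rightarrow> graded_iso_onto scaleM grM scaleN UNIV grN
         | Suc l \<Rightarrow> graded_iso_onto scaleM grM fscale (d l ` free_mod (D (Suc l))) (free_gr (D l))))"


section \<open>Graded Betti numbers\<close>

text \<open>
  With $K = S/\mathfrak m$ one has $F \otimes_S K = F/\mathfrak m F$, so $\mathrm{Tor}_i(M,K)_j$ is the
  degree \<open>j\<close> part of the homology of $F/\mathfrak m F$ at position \<open>i\<close>, for a free resolution \<open>F\<close> of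
  \<open>M\<close>. The following two sets are the preimages in $(F_i)_j$ of the cycles and of the boundaries. Both
  are finite-dimensional and the first contains the second, so the dimension of the quotient is the
  difference of the dimensions.
\<close>

definition tor_cycles ::
    "(nat \<Rightarrow> ('n::finite \<Rightarrow> int) list) \<Rightarrow> (nat \<Rightarrow> ('n, 'k::field) fvec \<Rightarrow> ('n, 'k) fvec) \<Rightarrow>
     nat \<Rightarrow> int \<Rightarrow> ('n, 'k) fvec set" where
  "tor_cycles D d i j = {v \<in> coarse (free_gr (D i)) j.
     case i of 0 \<Rightarrow> True | Suc l \<Rightarrow> d l v \<in> irrelevant_free (D l)}"

definition tor_boundaries ::
    "(nat \<Rightarrow> ('n::finite \<Rightarrow> int) list) \<Rightarrow> (nat \<Rightarrow> ('n, 'k::field) fvec \<Rightarrow> ('n, 'k) fvec) \<Rightarrow>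
     nat \<Rightarrow> int \<Rightarrow> ('n, 'k) fvec set" where
  "tor_boundaries D d i j =
     {d i w + u | w u. w \<in> coarse (free_gr (D (Suc i))) j \<and>
                       u \<in> irrelevant_free (D i) \<inter> coarse (free_gr (D i)) j}"

definition kdim :: "('n, 'k::field) fvec set \<Rightarrow> nat" where
  "kdim = vector_space.dim (\<lambda>c. fscale (const c))"

definition tor_dim ::
    "(nat \<Rightarrow> ('n::finite \<Rightarrow> int) list) \<Rightarrow> (nat \<Rightarrow> ('n, 'k::field) fvec \<Rightarrow> ('n, 'k) fvec) \<Rightarrow>
     nat \<Rightarrow> int \<Rightarrow> nat" where
  "tor_dim D d i j = kdim (tor_cycles D d i j) - kdim (tor_boundaries D d i j)"

text \<open>
  The dimension of $\mathrm{Tor}_i(M,K)_j$, computed from a chosen resolution (one by free modules of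
  finite rank exists when \<open>M\<close> is finitely generated). The index \<open>j\<close> is the internal degree, so this
  is $\beta_{i,j}$, and not $\beta_{i,i+j}$.
\<close>

definition betti ::
    "(('n::finite, 'k::field) mpoly \<Rightarrow> 'm::ab_group_add \<Rightarrow> 'm) \<Rightarrow> (('n \<Rightarrow> int) \<Rightarrow> 'm set) \<Rightarrow>
     nat \<Rightarrow> int \<Rightarrow> nat" where
  "betti scale gr i j =
     (case (SOME (D, d). \<exists>e. graded_free_resolution scale gr D d e) of (D, d) \<Rightarrow> tor_dim D d i j)"

definition betti_lin ::
    "(('n::finite, 'k::field) mpoly \<Rightarrow> 'm::ab_group_add \<Rightarrow> 'm) \<Rightarrow> (('n \<Rightarrow> int) \<Rightarrow> 'm set) \<Rightarrow>
     nat \<Rightarrow> nat" where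
  "betti_lin scale gr i = betti scale gr i (int i + initial_degree gr)"

end

theory Submission
  imports Defs
begin

text \<open>
  Let \<open>d\<close> be the initial degree of \<open>M\<close>. Since \<open>M\<close> vanishes below \<open>d\<close>, the linear strand of \<open>M\<close> is given by the
  Koszul cycles with coefficients in \<open>M\<^sub>d\<close>. Take a nonzero multigraded cycle \<open>z\<close> of homological degree \<open>p\<close> and
  let \<open>F\<close> be the simplicial complex generated by the sets \<open>G\<close> with nonzero coefficient \<open>z G\<close>. Contracting \<open>z\<close>
  along the faces of \<open>F\<close> with \<open>p - i\<close> elements gives nonzero cycles of homological degree \<open>i\<close> in pairwise
  different multidegrees, so \<open>\<beta>\<^sub>i\<close> is at least the number of these faces.

  A \<open>k\<close>-th syzygy module has no Koszul homology in degree \<open>q > 0\<close> on fewer than \<open>q + k\<close> variables, by dimension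
  shifting along the resolution. Hence a nonzero cycle of degree \<open>q > 0\<close> in the strand involves at least \<open>q + k\<close>
  variables. For the contraction along a face \<open>T\<close> this bounds the number of vertices in the link of \<open>T\<close> from
  below by \<open>p + k - card T\<close>, and double counting gives at least \<open>p + k\<close> choose \<open>s\<close> faces with \<open>s \<le> p\<close> elements.
\<close>

section \<open>The Koszul complex\<close>

text \<open>The Betti numbers are read off from one resolution, picked by \<open>SOME\<close>.
  Koszul homology with coefficients in M does not mention it, and a staircase in a double complex
  joins the two sides. Only nonvanishing in each multidegree is carried across, never a dimension.
  That suffices because the lower bound counts multidegrees, and Tor classes in different
  multidegrees are linearly independent.

  In the linear strand every nonzero cycle is a nonzero class: a chain of homological degree q + 1
  in total degree q + d has coefficients in degree d - 1, where M vanishes. So a contraction, which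
  anticommutes with the Koszul differential, only has to be nonzero in order to yield a class.

  The number q + k comes from the shifting: each passage to the preceding syzygy raises the
  homological degree by one, and after k passages it exceeds the number of variables, so that no
  chains are left. Faces with p - i elements give the claimed bound because p + k choose p - i
  equals p + k choose i + k.\<close>

definition var_rank :: "'n::finite \<Rightarrow> nat" where
  "var_rank = (SOME f. inj f)"

lemma var_rank_eq_iff:
  fixes i j :: "'n::finite"
  shows "var_rank i = var_rank j \<longleftrightarrow> i = j"
proof -
  obtain f :: "'n \<Rightarrow> nat" where "inj f"
    using finite_imp_inj_to_nat_seg[OF finite_class.finite_UNIV] by blast
  then have "inj (var_rank :: 'n \<Rightarrow> nat)"
    unfolding var_rank_def by (rule someI[of inj])
  then show ?thesis by (simp add: inj_eq)
qed

text \<open>\<open>'n\<close> carries no order, so positions are compared through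
  \<open>var_rank\<close>. The value is the sign of moving the i-th exterior generator past the
  smaller elements of G; by the strict inequality it does not matter whether i itself lies in
  G.\<close>

definition koszul_sign :: "'n::finite \<Rightarrow> 'n set \<Rightarrow> 'k::field" where
  "koszul_sign i G = (- 1) ^ card {j \<in> G. var_rank j < var_rank i}"

lemma koszul_sign_insert:
  assumes "j \<notin> G"
  shows "koszul_sign i (insert j G) = (if var_rank j < var_rank i then - koszul_sign i G else koszul_sign i G)"
proof -
  have "{l \<in> insert j G. var_rank l < var_rank i} =
      (if var_rank j < var_rank i then insert j {l \<in> G. var_rank l < var_rank i} else {l \<in> G. var_rank l
          < var_rank i})"
    by auto
  then show ?thesis using assms by (simp add: koszul_sign_def)
qed

lemma koszul_sign_insert_self [simp]: "koszul_sign i (insert i G) = koszul_sign i G"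
proof -
  have "{j \<in> insert i G. var_rank j < var_rank i} = {j \<in> G. var_rank j < var_rank i}" by auto
  then show ?thesis by (simp add: koszul_sign_def)
qed

lemma koszul_sign_mult_self [simp]: "koszul_sign i G * koszul_sign i G = 1"
  by (simp add: koszul_sign_def flip: power_mult_distrib)

text \<open>Exactly one of i and j has the smaller rank, so exactly one of the two insertions flips
  a sign. This anticommutativity of the exterior generators is behind both
  \<open>koszul_koszul\<close> and \<open>koszul_contract\<close>.\<close>

lemma koszul_sign_swap:
  assumes "i \<noteq> j" "i \<notin> G" "j \<notin> G"
  shows "koszul_sign i G * koszul_sign j (insert i G) = - (koszul_sign j G * koszul_sign i (insert j G))"
  using assms var_rank_eq_iff[of i j] by (auto simp: koszul_sign_insert)

abbreviation linear_term :: "'n \<Rightarrow> 'k::zero \<Rightarrow> ('n, 'k) mpoly" where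
  "linear_term i c \<equiv> Poly_Mapping.single (Poly_Mapping.single i 1) c"

text \<open>A chain is stored by its coefficients z G on the exterior basis, so the differential is
  written as what arrives at G: removing i from \<open>insert i G\<close> multiplies by the i-th
  variable, with a sign.\<close>

definition koszul ::
    "(('n::finite, 'k::field) mpoly \<Rightarrow> 'm::ab_group_add \<Rightarrow> 'm) \<Rightarrow> ('n set \<Rightarrow> 'm) \<Rightarrow> 'n set \<Rightarrow> 'm" where
  "koszul scale z G = (\<Sum>i\<in>-G. scale (linear_term i (koszul_sign i G)) (z (insert i G)))"

text \<open>The exterior generator of G has the indicator vector of G as its degree, so in
  multidegree a its coefficient has this degree.\<close>

definition sub_deg :: "('n \<Rightarrow> int) \<Rightarrow> 'n set \<Rightarrow> 'n \<Rightarrow> int" where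
  "sub_deg a G = (\<lambda>l. a l - (if l \<in> G then 1 else 0))"

text \<open>\<open>V\<close> selects the Koszul complex on a subset of the variables, which is what
  the vanishing for syzygy modules is about.\<close>

definition koszul_chains ::
    "(('n \<Rightarrow> int) \<Rightarrow> 'm::zero set) \<Rightarrow> 'n set \<Rightarrow> nat \<Rightarrow> ('n \<Rightarrow> int) \<Rightarrow> ('n set \<Rightarrow> 'm) set" where
  "koszul_chains gr V p a =
     {z. (\<forall>G. z G \<in> gr (sub_deg a G)) \<and> (\<forall>G. z G \<noteq> 0 \<longrightarrow> G \<subseteq> V \<and> card G = p)}"

lemma koszul_chainsI:
  assumes "\<And>G. z G \<in> gr (sub_deg a G)" and "\<And>G. z G \<noteq> 0 \<Longrightarrow> G \<subseteq> V \<and> card G = p"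
  shows "z \<in> koszul_chains gr V p a"
  using assms by (simp add: koszul_chains_def)

lemma koszul_chainsD:
  assumes "z \<in> koszul_chains gr V p a"
  shows "z G \<in> gr (sub_deg a G)" and "z G \<noteq> 0 \<Longrightarrow> G \<subseteq> V" and "z G \<noteq> 0 \<Longrightarrow> card G = p"
  using assms by (auto simp: koszul_chains_def)

lemma shift_sub_deg_insert:
  "i \<notin> G \<Longrightarrow> shift (Poly_Mapping.single i 1) (sub_deg a (insert i G)) = sub_deg a G"
  by (auto simp: shift_def sub_deg_def lookup_single when_def)

lemma shift_zero [simp]: "shift 0 a = a"
  by (simp add: shift_def)

lemma sub_deg_empty [simp]: "sub_deg a {} = a"
  by (simp add: sub_deg_def)

lemma sub_deg_union: "G \<inter> T = {} \<Longrightarrow> sub_deg (sub_deg a T) G = sub_deg a (T \<union> G)"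
  by (auto simp: sub_deg_def fun_eq_iff)

lemma inj_sub_deg: "inj (sub_deg a)"
proof
  fix G H assume "sub_deg a G = sub_deg a H"
  then have "\<forall>l. (l \<in> G) = (l \<in> H)" by (auto simp: sub_deg_def fun_eq_iff split: if_splits)
  then show "G = H" by blast
qed

lemma total_sub_deg: "total (sub_deg a G) = total a - int (card (G :: 'n::finite set))"
proof -
  have "(\<Sum>l\<in>UNIV. if l \<in> G then 1 else 0) = int (card G)"
    by (simp add: sum.If_cases)
  then show ?thesis by (simp add: total_def sub_deg_def sum_subtractf)
qed


text \<open>Keeps of \<open>zn_graded_module\<close> what the free modules share:
  \<open>free_gr D\<close> fills only \<open>free_mod D\<close> and not the whole ambient type, so
  \<open>gr_direct\<close> fails for it.\<close>

locale graded_family = module scale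
  for scale :: "('n::finite, 'k::field) mpoly \<Rightarrow> 'm::ab_group_add \<Rightarrow> 'm" +
  fixes gr :: "('n \<Rightarrow> int) \<Rightarrow> 'm set"
  assumes gr_zero: "0 \<in> gr a"
    and gr_add: "x \<in> gr a \<Longrightarrow> y \<in> gr a \<Longrightarrow> x + y \<in> gr a"
    and gr_scale: "x \<in> gr a \<Longrightarrow> scale (Poly_Mapping.single t c) x \<in> gr (shift t a)"
begin

lemma gr_const: "x \<in> gr a \<Longrightarrow> scale (const c) x \<in> gr a"
  using gr_scale[of x a 0 c] by (simp add: const_def)

lemma gr_minus: "x \<in> gr a \<Longrightarrow> - x \<in> gr a"
  using gr_const[of x a "- 1"] by (simp add: const_def single_uminus)

lemma gr_diff: "x \<in> gr a \<Longrightarrow> y \<in> gr a \<Longrightarrow> x - y \<in> gr a"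
  using gr_add[of x a "- y"] gr_minus by simp

lemma gr_sum: "(\<And>i. i \<in> A \<Longrightarrow> f i \<in> gr a) \<Longrightarrow> (\<Sum>i\<in>A. f i) \<in> gr a"
  by (induction A rule: infinite_finite_induct) (auto simp: gr_zero gr_add)

text \<open>The term for (i, j) cancels the one for (j, i). \<open>A\<close> holds the pairs of
  increasing rank, its mirror image the others.\<close>

lemma koszul_koszul: "koszul scale (koszul scale z) G = 0"
proof -
  define f where "f = (\<lambda>(i, j). scale (Poly_Mapping.single (Poly_Mapping.single i 1 + Poly_Mapping.single j 1)
      (koszul_sign i G * koszul_sign j (insert i G))) (z (insert j (insert i G))))"
  define P where "P = {(i, j). i \<notin> G \<and> j \<notin> G \<and> i \<noteq> j}"
  define A where "A = {(i, j). i \<notin> G \<and> j \<notin> G \<and> var_rank i < var_rank j}"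
  have P: "P = A \<union> prod.swap ` A" "A \<inter> prod.swap ` A = {}"
    using var_rank_eq_iff by (fastforce simp: P_def A_def image_iff)+
  have swap: "f (prod.swap x) = - f x" if "x \<in> A" for x
  proof -
    obtain i j where x: "x = (i, j)" by force
    then have ij: "i \<notin> G" "j \<notin> G" "i \<noteq> j" using that by (auto simp: A_def)
    show ?thesis
      unfolding x f_def using koszul_sign_swap[OF ij(3,1,2), where ?'b='k]
      by (simp add: insert_commute add.commute single_uminus)
  qed
  have "koszul scale (koszul scale z) G = (\<Sum>i\<in>-G. \<Sum>j\<in>-insert i G. f (i, j))"
    by (simp add: koszul_def scale_sum_right f_def mult_single)
  also have "\<dots> = sum f (Sigma (- G) (\<lambda>i. - insert i G))"
    by (subst sum.Sigma) auto
  also have "Sigma (- G) (\<lambda>i. - insert i G) = P"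
    by (auto simp: P_def)
  also have "sum f P = sum f A + sum f (prod.swap ` A)"
    unfolding P(1) by (rule sum.union_disjoint) (use P(2) in \<open>auto simp: finite_class.finite\<close>)
  also have "sum f (prod.swap ` A) = (\<Sum>x\<in>A. - f x)"
    by (subst sum.reindex) (auto simp: swap)
  finally show ?thesis by (simp add: sum_negf)
qed

lemma koszul_in_chains:
  assumes z: "z \<in> koszul_chains gr V (Suc p) a"
  shows "koszul scale z \<in> koszul_chains gr V p a"
proof (rule koszul_chainsI)
  fix G
  have "scale (linear_term i (koszul_sign i G)) (z (insert i G)) \<in> gr (sub_deg a G)" if "i \<in> - G" for i
    using gr_scale[OF koszul_chainsD(1)[OF z, of "insert i G"], of "Poly_Mapping.single i 1"]
      shift_sub_deg_insert[of i G a] that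
    by simp
  then show "koszul scale z G \<in> gr (sub_deg a G)"
    unfolding koszul_def by (rule gr_sum)
next
  fix G assume "koszul scale z G \<noteq> 0"
  then obtain i where i: "i \<in> - G" "z (insert i G) \<noteq> 0"
    unfolding koszul_def by (metis (no_types, lifting) scale_zero_right sum.neutral)
  have "card (insert i G) = Suc p" "insert i G \<subseteq> V" using koszul_chainsD(2,3)[OF z i(2)] by auto
  then show "G \<subseteq> V \<and> card G = p" using i(1) by simp
qed

lemma koszul_diff: "koszul scale (\<lambda>G. y G - z G) G = koszul scale y G - koszul scale z G"
  by (simp add: koszul_def scale_right_diff_distrib sum_subtractf)

lemma chains_zero: "(\<lambda>G. 0) \<in> koszul_chains gr V p a"
  by (simp add: koszul_chains_def gr_zero)

lemma koszul_zero: "koszul scale (\<lambda>G. 0) G = 0"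
  by (simp add: koszul_def)

lemma chains_diff:
  assumes "y \<in> koszul_chains gr V p a" and "z \<in> koszul_chains gr V p a"
  shows "(\<lambda>G. y G - z G) \<in> koszul_chains gr V p a"
proof (rule koszul_chainsI)
  show "y G - z G \<in> gr (sub_deg a G)" for G
    using koszul_chainsD(1)[OF assms(1)] koszul_chainsD(1)[OF assms(2)] by (rule gr_diff)
  show "G \<subseteq> V \<and> card G = p" if "y G - z G \<noteq> 0" for G
    using that koszul_chainsD[OF assms(1), of G] koszul_chainsD[OF assms(2), of G] by (cases "y G = 0") auto
qed

end

lemma koszul_hom:
  assumes "module_hom s1 s2 f"
  shows "koszul s2 (\<lambda>G. f (z G)) G = f (koszul s1 z G)"
proof -
  interpret module_hom s1 s2 f by fact
  show ?thesis by (simp add: koszul_def sum scale)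
qed

lemma chains_hom:
  assumes "module_hom s1 s2 f" and "\<And>a. f ` gr1 a \<subseteq> gr2 a" and z: "z \<in> koszul_chains gr1 V p a"
  shows "(\<lambda>G. f (z G)) \<in> koszul_chains gr2 V p a"
proof -
  interpret module_hom s1 s2 f by fact
  show ?thesis
  proof (rule koszul_chainsI)
    show "f (z G) \<in> gr2 (sub_deg a G)" for G
      using assms(2) koszul_chainsD(1)[OF z] by blast
    show "G \<subseteq> V \<and> card G = p" if "f (z G) \<noteq> 0" for G
      using that koszul_chainsD(2,3)[OF z, of G] zero by metis
  qed
qed

lemma chains_lift:
  assumes "graded_family s1 gr1" and "module_hom s1 s2 f" and z: "z \<in> koszul_chains gr2 V p a"
    and lift: "\<And>G b. z G \<in> gr2 b \<Longrightarrow> \<exists>y\<in>gr1 b. f y = z G"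
  obtains w where "w \<in> koszul_chains gr1 V p a" "\<And>G. f (w G) = z G"
proof -
  interpret graded_family s1 gr1 by fact
  interpret f: module_hom s1 s2 f by fact
  \<comment> \<open>Zero coefficients get the lift zero; thus the support does not grow, and the
    conditions on V and p survive.\<close>
  have "\<exists>y\<in>gr1 (sub_deg a G). f y = z G \<and> (z G = 0 \<longrightarrow> y = 0)" for G
    using lift[OF koszul_chainsD(1)[OF z]] gr_zero f.zero by metis
  then obtain w where w: "\<And>G. w G \<in> gr1 (sub_deg a G) \<and> f (w G) = z G \<and> (z G = 0 \<longrightarrow> w G = 0)"
    by metis
  show ?thesis
  proof (rule that)
    show "w \<in> koszul_chains gr1 V p a"
      using w koszul_chainsD(2,3)[OF z] by (intro koszul_chainsI) metis+
  qed (simp add: w)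
qed

section \<open>Acyclicity for free modules\<close>

lemma lookup_single_times_add:
  fixes q :: "('a::cancel_comm_monoid_add) \<Rightarrow>\<^sub>0 ('k::semiring_0)"
  shows "Poly_Mapping.lookup (Poly_Mapping.single s c * q) (s + u) = c * Poly_Mapping.lookup q u"
proof -
  have "(\<Sum>v. Poly_Mapping.lookup q v when s + u = s + v) = Poly_Mapping.lookup q u"
    by simp
  then have "Poly_Mapping.lookup (Poly_Mapping.single s c * q) (s + u) =
      (\<Sum>l. c * Poly_Mapping.lookup q u when l = s)"
    unfolding lookup_mult lookup_single
    by (intro Sum_any.cong) (auto simp: when_def)
  then show ?thesis by simp
qed

lemma lookup_single_times_eq_0:
  fixes q :: "('a::cancel_comm_monoid_add) \<Rightarrow>\<^sub>0 ('k::semiring_0)"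
  assumes "\<And>u. t \<noteq> s + u"
  shows "Poly_Mapping.lookup (Poly_Mapping.single s c * q) t = 0"
proof -
  have "Poly_Mapping.lookup (Poly_Mapping.single s c * q) t = (\<Sum>l::'a. 0::'k)"
    unfolding lookup_mult lookup_single using assms
    by (intro Sum_any.cong) (auto simp: when_def)
  then show ?thesis by simp
qed

lemma lookup_const_times: "Poly_Mapping.lookup (const c * q) t = c * Poly_Mapping.lookup q t"
  using lookup_single_times_add[of 0 c q t] by (simp add: const_def)

lemma single_add_diff:
  fixes t :: "'n \<Rightarrow>\<^sub>0 nat"
  assumes "Poly_Mapping.lookup t i > 0"
  obtains u where "t = Poly_Mapping.single i 1 + u"
proof
  show "t = Poly_Mapping.single i 1 + (t - Poly_Mapping.single i 1)"
    using assms by (intro poly_mapping_eqI) (auto simp: lookup_add lookup_minus lookup_single when_def)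
qed

lemma lookup_linear_term_times_eq_0:
  "Poly_Mapping.lookup t i = 0 \<Longrightarrow> Poly_Mapping.lookup (linear_term i c * q) t = (0::'k::semiring_0)"
  by (rule lookup_single_times_eq_0) (auto simp: lookup_add)

text \<open>Division by the j-th variable. Pulling back along the addition of the j-th exponent
  drops all monomials that the variable does not divide.\<close>

definition divx :: "'n \<Rightarrow> ('n, 'k::zero) mpoly \<Rightarrow> ('n, 'k) mpoly" where
  "divx j = Poly_Mapping.map_key (\<lambda>t. Poly_Mapping.single j 1 + t)"

lemma lookup_divx: "Poly_Mapping.lookup (divx j q) t = Poly_Mapping.lookup q (Poly_Mapping.single j 1 + t)"
  by (simp add: divx_def map_key.rep_eq)

lemma divx_sum: "divx j (\<Sum>i\<in>A. f i) = (\<Sum>i\<in>A. divx j (f i))"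
  by (rule poly_mapping_eqI) (simp add: lookup_divx lookup_sum)

lemma divx_linear_term_same: "divx j (linear_term j c * q) = const c * (q :: ('n, 'k::semiring_0) mpoly)"
  by (rule poly_mapping_eqI) (simp only: lookup_divx lookup_single_times_add lookup_const_times)

text \<open>Multiplication by another variable does not affect divisibility by the j-th one, so the
  two operations commute.\<close>

lemma divx_linear_term_other:
  fixes q :: "('n, 'k::semiring_0) mpoly"
  assumes "i \<noteq> j"
  shows "divx j (linear_term i c * q) = linear_term i c * divx j q"
proof (rule poly_mapping_eqI)
  fix t
  show "Poly_Mapping.lookup (divx j (linear_term i c * q)) t =
      Poly_Mapping.lookup (linear_term i c * divx j q) t"
  proof (cases "Poly_Mapping.lookup t i > 0")
    case True
    then obtain u where t: "t = Poly_Mapping.single i 1 + u" by (rule single_add_diff)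
    have "Poly_Mapping.single j 1 + t = Poly_Mapping.single i 1 + (Poly_Mapping.single j 1 + u)"
      by (simp add: t add.left_commute)
    then show ?thesis
      by (simp only: lookup_divx lookup_single_times_add) (simp only: t lookup_divx lookup_single_times_add)
  next
    case False
    then show ?thesis using assms
      by (simp add: lookup_divx lookup_linear_term_times_eq_0 lookup_add lookup_single del: One_nat_def)
  qed
qed

lemma linear_term_times_divx:
  fixes q :: "('n, 'k::semiring_0) mpoly"
  assumes "\<And>t. t \<in> Poly_Mapping.keys q \<Longrightarrow> Poly_Mapping.lookup t j > 0"
  shows "linear_term j c * divx j q = const c * q"
proof (rule poly_mapping_eqI)
  fix t
  show "Poly_Mapping.lookup (linear_term j c * divx j q) t = Poly_Mapping.lookup (const c * q) t"
  proof (cases "Poly_Mapping.lookup t j > 0")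
    case True
    then obtain u where t: "t = Poly_Mapping.single j 1 + u" by (rule single_add_diff)
    show ?thesis by (simp only: t lookup_divx lookup_single_times_add lookup_const_times)
  next
    case False
    then have "Poly_Mapping.lookup q t = 0" using assms by (metis in_keys_iff)
    then show ?thesis using False
      by (simp add: lookup_const_times lookup_linear_term_times_eq_0 del: One_nat_def)
  qed
qed

lemma const_times_linear_term: "const c * linear_term i d = linear_term i (c * d :: 'k::semiring_0)"
  by (simp add: const_def mult_single)

lemma const_mult: "const c * const d = const (c * d :: 'k::semiring_0)"
  by (simp add: const_def mult_single)

lemma const_1 [simp]: "const (1::'k::field) = 1"
  by (simp add: const_def)

section \<open>A contracting homotopy for the Koszul complex\<close>

lemma koszul_sign_exchange:
  assumes "i \<noteq> j" "i \<notin> H" "j \<notin> H"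
  shows "koszul_sign i (insert j H) * koszul_sign j (insert i (insert j H)) =
      - (koszul_sign j H * koszul_sign i H)"
  using assms var_rank_eq_iff[of i j] by (auto simp: koszul_sign_insert insert_commute[of i j])

text \<open>The wedge product of the j-th exterior generator with z, after division of the
  coefficients by the j-th variable.\<close>

definition koszul_homotopy :: "'n::finite \<Rightarrow> ('n set \<Rightarrow> ('n, 'k::field) mpoly) \<Rightarrow> 'n set \<Rightarrow> ('n, 'k) mpoly" where
  "koszul_homotopy j z G = (if j \<in> G then const (koszul_sign j G) * divx j (z (G - {j})) else 0)"

text \<open>For j outside G only the term i = j survives, and by \<open>pos\<close> it multiplies
  back what was divided. For j in G the cycle condition at G without j determines z G from the other
  coefficients.\<close>

lemma koszul_koszul_homotopy:
  fixes z :: "'n::finite set \<Rightarrow> ('n, 'k::field) mpoly"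
  assumes cycle: "\<And>G. koszul (*) z G = 0"
    and pos: "\<And>G t. j \<notin> G \<Longrightarrow> t \<in> Poly_Mapping.keys (z G) \<Longrightarrow> Poly_Mapping.lookup t j > 0"
  shows "koszul (*) (koszul_homotopy j z) G = z G"
proof (cases "j \<in> G")
  case False
  have "koszul (*) (koszul_homotopy j z) G =
      (\<Sum>i\<in>-G. if i = j then linear_term j (koszul_sign j G) * koszul_homotopy j z (insert j G) else 0)"
    unfolding koszul_def by (rule sum.cong) (use False in \<open>auto simp: koszul_homotopy_def\<close>)
  also have "\<dots> = linear_term j (koszul_sign j G) * (const (koszul_sign j G) * divx j (z G))"
    using False by (simp add: koszul_homotopy_def)
  also have "\<dots> = const (koszul_sign j G) * (linear_term j (koszul_sign j G) * divx j (z G))"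
    by (rule mult.left_commute)
  also have "\<dots> = z G"
    using False pos[of G] by (subst linear_term_times_divx) (simp_all add: const_mult flip: mult.assoc)
  finally show ?thesis .
next
  case True
  define H where "H = G - {j}"
  have G: "G = insert j H" "j \<notin> H" using True by (auto simp: H_def)
  define S where "S = (\<Sum>i\<in>-G. linear_term i (koszul_sign i H) * divx j (z (insert i H)))"
  \<comment> \<open>In the cycle condition at H the term i = j is, up to sign, the j-th variable
    times z G; dividing by that variable isolates z G.\<close>
  have "0 = divx j (koszul (*) z H)"
    by (simp add: cycle) (simp add: poly_mapping_eq_iff lookup_divx fun_eq_iff)
  also have "\<dots> = (\<Sum>i\<in>-H. divx j (linear_term i (koszul_sign i H) * z (insert i H)))"
    by (simp add: koszul_def divx_sum)
  also have "- H = insert j (- G)" using G by auto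
  also have "(\<Sum>i\<in>insert j (- G). divx j (linear_term i (koszul_sign i H) * z (insert i H))) =
      const (koszul_sign j H) * z G + (\<Sum>i\<in>-G. divx j (linear_term i (koszul_sign i H) * z (insert i H)))"
    using True by (simp add: divx_linear_term_same G(1) del: One_nat_def)
  also have "(\<Sum>i\<in>-G. divx j (linear_term i (koszul_sign i H) * z (insert i H))) = S"
    unfolding S_def by (rule sum.cong) (use True in \<open>auto intro: divx_linear_term_other simp del: One_nat_def\<close>)
  finally have "const (koszul_sign j H) * z G = - S"
    by (simp add: eq_neg_iff_add_eq_0)
  then have "const (koszul_sign j H) * (const (koszul_sign j H) * z G) = const (koszul_sign j H) * (- S)"
    by simp
  then have zG: "z G = - (const (koszul_sign j H) * S)"
    by (simp add: const_mult flip: mult.assoc)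
  have "koszul (*) (koszul_homotopy j z) G =
      (\<Sum>i\<in>-G. - (const (koszul_sign j H) * (linear_term i (koszul_sign i H) * divx j (z (insert i H)))))"
    unfolding koszul_def
  proof (rule sum.cong)
    fix i assume i: "i \<in> - G"
    then have ij: "i \<noteq> j" "i \<notin> H" using G by auto
    have "insert i G - {j} = insert i H" using G ij by auto
    then have "linear_term i (koszul_sign i G) * koszul_homotopy j z (insert i G) =
        const (koszul_sign j (insert i G)) * linear_term i (koszul_sign i G) * divx j (z (insert i H))"
      using True by (simp add: koszul_homotopy_def ac_simps)
    also have "const (koszul_sign j (insert i G)) * linear_term i (koszul_sign i G)
        = - (const (koszul_sign j H) * linear_term i (koszul_sign i H) :: ('n, 'k) mpoly)"
      using koszul_sign_exchange[OF ij(1,2) G(2), where ?'b = 'k]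
      by (simp add: const_times_linear_term G(1) single_uminus mult.commute del: One_nat_def
          koszul_sign_insert_self)
    finally show "linear_term i (koszul_sign i G) * koszul_homotopy j z (insert i G) =
        - (const (koszul_sign j H) * (linear_term i (koszul_sign i H) * divx j (z (insert i H))))"
      by (simp add: mult.assoc)
  qed simp
  also have "\<dots> = - (const (koszul_sign j H) * S)"
    by (simp add: S_def sum_negf sum_distrib_left)
  finally show ?thesis using zG by simp
qed

lemma koszul_homotopy_degree:
  assumes "\<And>G t. t \<in> Poly_Mapping.keys (z G) \<Longrightarrow> shift t b = sub_deg a G"
    and t: "t \<in> Poly_Mapping.keys (koszul_homotopy j z G)"
  shows "shift t b = sub_deg a G"
proof -
  have j: "j \<in> G" using t by (auto simp: koszul_homotopy_def split: if_splits)
  then have "Poly_Mapping.single j 1 + t \<in> Poly_Mapping.keys (z (G - {j}))"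
    using t by (auto simp: koszul_homotopy_def in_keys_iff lookup_const_times lookup_divx)
  then have "shift (Poly_Mapping.single j 1 + t) b = sub_deg a (G - {j})" by (rule assms(1))
  then have *: "int (Poly_Mapping.lookup (Poly_Mapping.single j 1 + t) l) + b l = sub_deg a (G - {j}) l" for l
    by (simp add: shift_def fun_eq_iff)
  have "int (Poly_Mapping.lookup t l) + b l = sub_deg a G l" for l
    using j *[of l] by (cases "l = j") (auto simp: lookup_add lookup_single sub_deg_def when_def)
  then show ?thesis by (simp add: shift_def fun_eq_iff)
qed

lemma koszul_homotopy_support:
  assumes "\<And>G. z G \<noteq> 0 \<Longrightarrow> G \<subseteq> V \<and> card G = p" and "j \<in> V" and "koszul_homotopy j z G \<noteq> 0"
  shows "G \<subseteq> V \<and> card G = Suc p"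
proof -
  have j: "j \<in> G" using assms(3) by (auto simp: koszul_homotopy_def split: if_splits)
  moreover have "z (G - {j}) \<noteq> 0"
  proof
    assume "z (G - {j}) = 0"
    then have "koszul_homotopy j z G = const (koszul_sign j G) * divx j 0" using j
        by (simp add: koszul_homotopy_def)
    also have "\<dots> = 0"
        by (rule poly_mapping_eqI) (simp only: lookup_const_times lookup_divx lookup_zero mult_zero_right)
    finally show False using assms(3) by simp
  qed
  from assms(1)[OF this] show ?thesis using j assms(2)
    by (metis Diff_subset_conv card.insert_remove finite_class.finite insert_absorb insert_subset
        singletonD insert_Diff_single subset_insert_iff)
qed

section \<open>Graded free modules and exactness of their Koszul complexes\<close>

lemma free_gr_iff:
  "v \<in> free_gr D a \<longleftrightarrow> (\<forall>r\<ge>length D. Poly_Mapping.lookup v r = 0) \<and>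
     (\<forall>r<length D. \<forall>t\<in>Poly_Mapping.keys (Poly_Mapping.lookup v r). shift t (D ! r) = a)"
  unfolding free_gr_def free_mod_def by (auto simp: in_keys_iff subset_iff) (metis leI)

lemma free_mod_iff: "v \<in> free_mod D \<longleftrightarrow> (\<forall>r\<ge>length D. Poly_Mapping.lookup v r = 0)"
  unfolding free_mod_def by (auto simp: in_keys_iff subset_iff) (metis leI)

lemma shift_add: "shift (s + t) a = shift s (shift t a)"
  by (auto simp: shift_def lookup_add)

lemma graded_family_free: "graded_family fscale (free_gr D :: _ \<Rightarrow> ('n::finite, 'k::field) fvec set)"
proof -
  interpret module "fscale :: ('n, 'k) mpoly \<Rightarrow> _" by (rule module_fscale)
  show ?thesis
  proof
    fix a x y t and c :: 'k
    show "0 \<in> (free_gr D a :: ('n, 'k) fvec set)" by (simp add: free_gr_iff)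
    show "x + y \<in> free_gr D a" if "x \<in> free_gr D a" "y \<in> (free_gr D a :: ('n, 'k) fvec set)"
      using that keys_add by (fastforce simp: free_gr_iff lookup_add)
    show "fscale (Poly_Mapping.single t c) x \<in> free_gr D (shift t a)"
        if "x \<in> (free_gr D a :: ('n, 'k) fvec set)"
    proof -
      have "shift u (D ! r) = shift t a"
        if "r < length D" "u \<in> Poly_Mapping.keys (Poly_Mapping.single t c * Poly_Mapping.lookup x r)" for r u
      proof -
        have "Poly_Mapping.lookup (Poly_Mapping.single t c * Poly_Mapping.lookup x r) u \<noteq> 0"
          using that(2) by (simp add: in_keys_iff)
        then obtain v where v: "u = t + v" using lookup_single_times_eq_0 by metis
        then have "v \<in> Poly_Mapping.keys (Poly_Mapping.lookup x r)"
          using that(2) by (auto simp: in_keys_iff lookup_single_times_add)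
        then show ?thesis using \<open>x \<in> free_gr D a\<close> that(1) v by (simp add: free_gr_iff shift_add)
      qed
      then show ?thesis using that by (simp add: free_gr_iff lookup_fscale)
    qed
  qed
qed

lemma koszul_fscale_lookup:
  "Poly_Mapping.lookup (koszul fscale z G) r = koszul (*) (\<lambda>G. Poly_Mapping.lookup (z G) r) G"
  by (simp add: koszul_def lookup_sum lookup_fscale)

text \<open>The complex splits over the basis elements r. If \<open>(D ! r) j < a j\<close> for some
  j in V, a monomial in a coefficient at a set without j has the positive exponent
  \<open>a j - (D ! r) j\<close> at j, so the homotopy for j applies; \<open>ex\<close> offers such
  a j unless coordinate r vanishes. Homological degree 0 is included for the sake of
  \<open>exists_koszul_preimage\<close>.\<close>

lemma koszul_free_exact_general:
  fixes z :: "'n::finite set \<Rightarrow> ('n, 'k::field) fvec"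
  assumes z: "z \<in> koszul_chains (free_gr D) V p a" and cycle: "\<And>G. koszul fscale z G = 0"
    and ex: "\<And>r G t. r < length D \<Longrightarrow> t \<in> Poly_Mapping.keys (Poly_Mapping.lookup (z G) r) \<Longrightarrow> \<exists>j\<in>V. (D ! r) j < a j"
  obtains w where "w \<in> koszul_chains (free_gr D) V (Suc p) a" "\<And>G. koszul fscale w G = z G"
proof -
  have *: "\<exists>w. \<forall>G. koszul (*) w G = Poly_Mapping.lookup (z G) r \<and> (w G \<noteq> 0 \<longrightarrow> G \<subseteq> V \<and> card G = Suc p)
       \<and> (\<forall>t\<in>Poly_Mapping.keys (w G). shift t (D ! r) = sub_deg a G)" if r: "r < length D" for r
  proof (cases "\<exists>j\<in>V. (D ! r) j < a j")
    case False
    then have "Poly_Mapping.lookup (z G) r = 0" for G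
      using ex[OF r] by (metis keys_eq_empty ex_in_conv)
    then show ?thesis by (intro exI[of _ "\<lambda>G. 0"]) (simp add: koszul_def)
  next
    case True
    then obtain j where j: "j \<in> V" "(D ! r) j < a j" by blast
    define y where "y = (\<lambda>G. Poly_Mapping.lookup (z G) r)"
    have deg: "shift t (D ! r) = sub_deg a G" if "t \<in> Poly_Mapping.keys (y G)" for G t
      using koszul_chainsD(1)[OF z, of G] r that by (simp add: free_gr_iff y_def)
    have supp: "G \<subseteq> V \<and> card G = p" if "y G \<noteq> 0" for G
      using koszul_chainsD(2,3)[OF z, of G] that by (metis lookup_zero y_def)
    have "Poly_Mapping.lookup t j > 0" if "j \<notin> G" "t \<in> Poly_Mapping.keys (y G)" for G t
      using fun_cong[OF deg[OF that(2)], of j] that(1) j(2) by (simp add: shift_def sub_deg_def)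
    then have "koszul (*) (koszul_homotopy j y) G = y G" for G
      by (intro koszul_koszul_homotopy) (simp_all add: y_def flip: koszul_fscale_lookup add: cycle)
    then show ?thesis
      using koszul_homotopy_degree[of y "D ! r" a, OF deg] koszul_homotopy_support[of y V p j, OF supp j(1)]
      by (intro exI[of _ "koszul_homotopy j y"]) (auto simp: y_def)
  qed
  have "\<forall>r. \<exists>w. r < length D \<longrightarrow> (\<forall>G. koszul (*) w G = Poly_Mapping.lookup (z G) r \<and> (w G \<noteq> 0 \<longrightarrow> G \<subseteq> V \<and>
      card G = Suc p)
       \<and> (\<forall>t\<in>Poly_Mapping.keys (w G). shift t (D ! r) = sub_deg a G))"
    using * by blast
  then obtain w where w: "\<And>r G. r < length D \<Longrightarrow> koszul (*) (w r) G = Poly_Mapping.lookup (z G) r"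
      "\<And>r G. r < length D \<Longrightarrow> w r G \<noteq> 0 \<Longrightarrow> G \<subseteq> V \<and> card G = Suc p"
      "\<And>r G t. r < length D \<Longrightarrow> t \<in> Poly_Mapping.keys (w r G) \<Longrightarrow> shift t (D ! r) = sub_deg a G"
    by metis
  define W where "W G = (\<Sum>r<length D. Poly_Mapping.single r (w r G))" for G
  have W: "Poly_Mapping.lookup (W G) r = (if r < length D then w r G else 0)" for G r
    unfolding W_def by (simp add: lookup_sum lookup_single when_def)
  show ?thesis
  proof (rule that)
    show "W \<in> koszul_chains (free_gr D) V (Suc p) a"
    proof (rule koszul_chainsI)
      show "W G \<in> free_gr D (sub_deg a G)" for G using w(3) by (simp add: free_gr_iff W)
      show "G \<subseteq> V \<and> card G = Suc p" if WG: "W G \<noteq> 0" for G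
      proof -
        obtain r where "Poly_Mapping.lookup (W G) r \<noteq> 0" using WG poly_mapping_eqI[of "W G" 0] by auto
        then show ?thesis using w(2) by (simp add: W split: if_splits)
      qed
    qed
    show "koszul fscale W G = z G" for G
    proof (rule poly_mapping_eqI)
      fix r
      have "Poly_Mapping.lookup (koszul fscale W G) r = koszul (*) (\<lambda>G. if r < length D then w r G else 0) G"
        by (simp only: koszul_fscale_lookup W)
      also have "\<dots> = Poly_Mapping.lookup (z G) r"
      proof (cases "r < length D")
        case False
        then show ?thesis
          using koszul_chainsD(1)[OF z, of G] by (simp add: koszul_def free_gr_iff)
      qed (simp add: w(1))
      finally show "Poly_Mapping.lookup (koszul fscale W G) r = Poly_Mapping.lookup (z G) r" .
    qed
  qed
qed

text \<open>In positive degree a set G with nonzero coefficient contains some j, and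
  \<open>(D ! r) j\<close> is at most the degree \<open>a j - 1\<close> of that coefficient at
  j.\<close>

lemma koszul_free_exact:
  fixes z :: "'n::finite set \<Rightarrow> ('n, 'k::field) fvec"
  assumes z: "z \<in> koszul_chains (free_gr D) V (Suc p) a" and cycle: "\<And>G. koszul fscale z G = 0"
  obtains w where "w \<in> koszul_chains (free_gr D) V (Suc (Suc p)) a" "\<And>G. koszul fscale w G = z G"
proof (rule koszul_free_exact_general[OF z cycle])
  fix r G t assume rt: "r < length D" "t \<in> Poly_Mapping.keys (Poly_Mapping.lookup (z G) r)"
  then have "z G \<noteq> 0" by auto
  then have "G \<noteq> {}" "G \<subseteq> V" using koszul_chainsD[OF z, of G] by auto
  then obtain j where j: "j \<in> G" "j \<in> V" by blast
  have "shift t (D ! r) = sub_deg a G"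
    using koszul_chainsD(1)[OF z, of G] rt by (simp add: free_gr_iff)
  from fun_cong[OF this, of j] show "\<exists>j\<in>V. (D ! r) j < a j"
    using j by (intro bexI[of _ j]) (auto simp: shift_def sub_deg_def)
qed (rule that)

section \<open>Homogeneous components\<close>

text \<open>Inside the free modules the decomposition is made by sorting monomials. Indices beyond D
  are cut off, so the value always lies in \<open>free_gr D a\<close>.\<close>

definition component :: "('n \<Rightarrow> int) list \<Rightarrow> ('n \<Rightarrow> int) \<Rightarrow> ('n, 'k::field) fvec \<Rightarrow> ('n, 'k) fvec" where
  "component D a = Poly_Mapping.mapp (\<lambda>r.
     Poly_Mapping.mapp (\<lambda>t c. if r < length D \<and> shift t (D ! r) = a then c else 0))"

lemma lookup_component:
  "Poly_Mapping.lookup (Poly_Mapping.lookup (component D a v) r) t =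
     (if r < length D \<and> shift t (D ! r) = a then Poly_Mapping.lookup (Poly_Mapping.lookup v r) t else 0)"
  by (auto simp: component_def lookup_mapp when_def in_keys_iff)

lemma fvec_eqI:
  "(\<And>r t. Poly_Mapping.lookup (Poly_Mapping.lookup v r) t =
      Poly_Mapping.lookup (Poly_Mapping.lookup w r) t) \<Longrightarrow> v = w"
  by (rule poly_mapping_eqI, rule poly_mapping_eqI)

lemma component_in_free_gr: "component D a v \<in> free_gr D a"
proof -
  have "Poly_Mapping.lookup (component D a v) r = 0" if "r \<ge> length D" for r
    using that by (intro poly_mapping_eqI) (simp add: lookup_component)
  then show ?thesis
    by (auto simp: free_gr_iff lookup_component in_keys_iff split: if_splits)
qed

lemma component_free_gr: "v \<in> free_gr D a \<Longrightarrow> component D b v = (if b = a then v else 0)"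
proof (rule fvec_eqI)
  fix r t assume v: "v \<in> free_gr D a"
  have "r < length D \<and> shift t (D ! r) = a" if "Poly_Mapping.lookup (Poly_Mapping.lookup v r) t \<noteq> 0"
    using v that by (cases "r < length D") (auto simp: free_gr_iff in_keys_iff)
  then show "Poly_Mapping.lookup (Poly_Mapping.lookup (component D b v) r) t =
      Poly_Mapping.lookup (Poly_Mapping.lookup (if b = a then v else 0) r) t"
    by (auto simp: lookup_component)
qed

lemma component_add: "component D a (v + w) = component D a v + component D a w"
  by (intro fvec_eqI) (simp add: lookup_component lookup_add)

lemma component_zero [simp]: "component D a 0 = 0"
  by (intro fvec_eqI) (simp add: lookup_component)

lemma component_sum: "component D a (\<Sum>i\<in>A. f i) = (\<Sum>i\<in>A. component D a (f i))"
  by (induction A rule: infinite_finite_induct) (auto simp: component_add)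

lemma component_fscale_const: "component D a (fscale (const c) v) = fscale (const c) (component D a v)"
  by (intro fvec_eqI) (simp add: lookup_component lookup_fscale lookup_const_times)

lemma free_gr_subset_free_mod: "free_gr D a \<subseteq> free_mod D"
  by (auto simp: free_gr_def)

definition degrees :: "('n \<Rightarrow> int) list \<Rightarrow> ('n, 'k::field) fvec \<Rightarrow> ('n \<Rightarrow> int) set" where
  "degrees D v = (\<Union>r<length D. (\<lambda>t. shift t (D ! r)) ` Poly_Mapping.keys (Poly_Mapping.lookup v r))"

lemma finite_degrees: "finite (degrees D v)"
  by (simp add: degrees_def)

lemma component_sum_degrees:
  assumes "v \<in> free_mod D"
  shows "(\<Sum>a\<in>degrees D v. component D a v) = v"
proof (rule fvec_eqI)
  fix r t
  have "Poly_Mapping.lookup (Poly_Mapping.lookup (\<Sum>a\<in>degrees D v. component D a v) r) t =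
      (\<Sum>a\<in>degrees D v. if a = shift t (D ! r) then
          if r < length D then Poly_Mapping.lookup (Poly_Mapping.lookup v r) t else 0 else 0)"
    by (auto simp: lookup_sum lookup_component intro!: sum.cong)
  also have "\<dots> = Poly_Mapping.lookup (Poly_Mapping.lookup v r) t"
  proof (cases "r < length D \<and> Poly_Mapping.lookup (Poly_Mapping.lookup v r) t \<noteq> 0")
    case True
    then have "shift t (D ! r) \<in> degrees D v"
      unfolding degrees_def by (intro UN_I[of r] imageI) (auto simp: in_keys_iff)
    then show ?thesis using True by (simp add: finite_degrees)
  next
    case False
    then have "Poly_Mapping.lookup (Poly_Mapping.lookup v r) t = 0"
      using assms by (cases "r < length D") (auto simp: free_mod_iff)
    then show ?thesis by (intro trans[OF sum.neutral]) auto
  qed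
  finally show "Poly_Mapping.lookup (Poly_Mapping.lookup (\<Sum>a\<in>degrees D v. component D a v) r) t =
      Poly_Mapping.lookup (Poly_Mapping.lookup v r) t" .
qed

text \<open>\<open>f\<close> is known to respect degrees on homogeneous elements, so v is split
  first; of the images of its components only the one in degree a survives.\<close>

lemma component_hom:
  assumes "module_hom fscale fscale f" and gr: "\<And>b. f ` free_gr D b \<subseteq> free_gr E b" and v: "v \<in> free_mod D"
  shows "component E a (f v) = f (component D a v)"
proof -
  interpret module_hom fscale fscale f by fact
  have "component E a (f v) = component E a (f (\<Sum>b\<in>degrees D v. component D b v))"
    using v by (simp add: component_sum_degrees)
  also have "\<dots> = (\<Sum>b\<in>degrees D v. component E a (f (component D b v)))"
    by (simp add: sum component_sum)
  also have "\<dots> = (\<Sum>b\<in>degrees D v. f (component D a (component D b v)))"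
  proof (rule sum.cong)
    fix b
    have "f (component D b v) \<in> free_gr E b" using gr component_in_free_gr by blast
    then show "component E a (f (component D b v)) = f (component D a (component D b v))"
      using component_free_gr[OF component_in_free_gr, of D a b v] by (simp add: component_free_gr zero)
  qed simp
  also have "\<dots> = f (component D a (\<Sum>b\<in>degrees D v. component D b v))"
    by (simp add: sum component_sum)
  finally show ?thesis using v by (simp add: component_sum_degrees)
qed

section \<open>Comparing Tor with Koszul homology\<close>

text \<open>Collects what happens inside the free modules, for a resolution of M and for one of N
  alike; \<open>module_resolution\<close> adds the grading axioms of the resolved module.\<close>

locale free_resolution =
  fixes scale :: "('n::finite, 'k::field) mpoly \<Rightarrow> 'm::ab_group_add \<Rightarrow> 'm"
    and gr :: "('n \<Rightarrow> int) \<Rightarrow> 'm set"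
    and D :: "nat \<Rightarrow> ('n \<Rightarrow> int) list"
    and d :: "nat \<Rightarrow> ('n, 'k) fvec \<Rightarrow> ('n, 'k) fvec"
    and e :: "('n, 'k) fvec \<Rightarrow> 'm"
  assumes resolution: "graded_free_resolution scale gr D d e"
begin

lemma e_hom: "module_hom fscale scale e" and e_gr: "e ` free_gr (D 0) a \<subseteq> gr a"
  and d_hom: "module_hom fscale fscale (d i)" and d_gr: "d i ` free_gr (D (Suc i)) a \<subseteq> free_gr (D i) a"
  and e_onto: "e ` free_mod (D 0) = UNIV"
  and exact_0: "d 0 ` free_mod (D (Suc 0)) = {v \<in> free_mod (D 0). e v = 0}"
  and exact_Suc: "d (Suc i) ` free_mod (D (Suc (Suc i))) = {v \<in> free_mod (D (Suc i)). d i v = 0}"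
  using resolution unfolding graded_free_resolution_def by simp_all

sublocale free: graded_family fscale "free_gr (D i)" for i
  by (rule graded_family_free)

sublocale d: module_hom fscale fscale "d i" for i
  by (rule d_hom)

sublocale e: module_hom fscale scale e
  by (rule e_hom)

lemma d_free_mod: "v \<in> free_mod (D (Suc i)) \<Longrightarrow> d i v \<in> free_mod (D i)"
  using imageI[of v "free_mod (D (Suc i))" "d i"] by (cases i) (simp_all add: exact_0 exact_Suc)

lemma d_d: "v \<in> free_mod (D (Suc (Suc i))) \<Longrightarrow> d i (d (Suc i) v) = 0"
  using imageI[of v "free_mod (D (Suc (Suc i)))" "d (Suc i)"] by (simp add: exact_Suc)

lemma e_d: "v \<in> free_mod (D (Suc 0)) \<Longrightarrow> e (d 0 v) = 0"
  using imageI[of v "free_mod (D (Suc 0))" "d 0"] by (simp add: exact_0)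

lemma component_d: "v \<in> free_mod (D (Suc i)) \<Longrightarrow> component (D i) a (d i v) = d i (component (D (Suc i)) a v)"
  by (rule component_hom[OF d_hom d_gr])

text \<open>Any preimage can be projected to degree a, because the differential commutes with the
  projections.\<close>

lemma lift_component:
  assumes "v \<in> free_gr (D i) a" and "v \<in> d i ` free_mod (D (Suc i))"
  shows "\<exists>w\<in>free_gr (D (Suc i)) a. d i w = v"
proof -
  obtain w where w: "w \<in> free_mod (D (Suc i))" "v = d i w" using assms(2) by blast
  have "d i (component (D (Suc i)) a w) = v"
    using component_d[OF w(1), of a] component_free_gr[OF assms(1), of a] w(2) by simp
  then show ?thesis using component_in_free_gr by blast
qed

lemma lift_0: "v \<in> free_gr (D 0) a \<Longrightarrow> e v = 0 \<Longrightarrow> \<exists>w\<in>free_gr (D (Suc 0)) a. d 0 w = v"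
  by (rule lift_component) (simp_all add: exact_0 subsetD[OF free_gr_subset_free_mod])

lemma lift_Suc: "v \<in> free_gr (D (Suc i)) a \<Longrightarrow> d i v = 0 \<Longrightarrow> \<exists>w\<in>free_gr (D (Suc (Suc i))) a. d (Suc i) w = v"
  by (rule lift_component) (simp_all add: exact_Suc subsetD[OF free_gr_subset_free_mod])

abbreviation (input) "K b V q a \<equiv> koszul_chains (free_gr (D b)) V q a"

lemma chain_free_mod: "z \<in> K b V q a \<Longrightarrow> z G \<in> free_mod (D b)"
  using koszul_chainsD(1) free_gr_subset_free_mod by blast

lemma koszul_d: "koszul fscale (\<lambda>G. d i (z G)) G = d i (koszul fscale z G)"
  by (rule koszul_hom[OF d_hom])

lemma koszul_e: "koszul scale (\<lambda>G. e (z G)) G = e (koszul fscale z G)"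
  by (rule koszul_hom[OF e_hom])

lemma chains_d: "z \<in> K (Suc i) V q a \<Longrightarrow> (\<lambda>G. d i (z G)) \<in> K i V q a"
  by (rule chains_hom[OF d_hom d_gr])

lemma chains_e: "z \<in> K 0 V q a \<Longrightarrow> (\<lambda>G. e (z G)) \<in> koszul_chains gr V q a"
  by (rule chains_hom[OF e_hom e_gr])

lemma chains_lift_0:
  assumes "z \<in> K 0 V q a" "\<And>G. e (z G) = 0"
  obtains w where "w \<in> K (Suc 0) V q a" "\<And>G. d 0 (w G) = z G"
  using chains_lift[OF graded_family_free d_hom assms(1) lift_0[OF _ assms(2)]] that by metis

lemma chains_lift_Suc:
  assumes "z \<in> K (Suc i) V q a" "\<And>G. d i (z G) = 0"
  obtains w where "w \<in> K (Suc (Suc i)) V q a" "\<And>G. d (Suc i) (w G) = z G"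
  using chains_lift[OF graded_family_free d_hom assms(1) lift_Suc[OF _ assms(2)]] that by metis

text \<open>Cycles and boundaries at position \<open>(q, b)\<close> of the double complex \<open>\<Lambda>\<^sup>q \<otimes> F\<^sub>b\<close>. Passing from
  \<open>(q, b + 1)\<close> to \<open>(q + 1, b)\<close> along the zigzag leads from the Tor of \<open>F \<otimes> K\<close> to Koszul homology.\<close>

definition zigzag_boundary :: "nat \<Rightarrow> nat \<Rightarrow> ('n \<Rightarrow> int) \<Rightarrow> ('n set \<Rightarrow> ('n, 'k) fvec) \<Rightarrow> bool" where
  "zigzag_boundary q b a w \<longleftrightarrow> (\<exists>y\<in>K b UNIV (Suc q) a. \<exists>y'\<in>K (Suc b) UNIV q a.
     \<forall>G. w G = koszul fscale y G + d b (y' G))"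

definition zigzag_cycle :: "nat \<Rightarrow> nat \<Rightarrow> ('n \<Rightarrow> int) \<Rightarrow> ('n set \<Rightarrow> ('n, 'k) fvec) \<Rightarrow> bool" where
  "zigzag_cycle q b a w \<longleftrightarrow> w \<in> K b UNIV q a \<and>
     (case b of 0 \<Rightarrow> \<forall>G. e (koszul fscale w G) = 0
      | Suc c \<Rightarrow> \<exists>u\<in>K c UNIV (Suc q) a. \<forall>G. d c (w G) = koszul fscale u G)"

text \<open>One corner of the staircase. From left to right, u - d y is a Koszul cycle because d d
  y' = 0, and Koszul exactness applies since the degree \<open>Suc q\<close> is positive. From right
  to left, d kills the difference of w and the Koszul differential of y', because the Koszul
  differential squares to zero, and the resolution is exact there.\<close>

lemma zigzag_boundary_step:
  assumes w: "w \<in> K (Suc b) UNIV q a" and u: "u \<in> K b UNIV (Suc q) a"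
    and wu: "\<And>G. d b (w G) = koszul fscale u G"
  shows "zigzag_boundary q (Suc b) a w \<longleftrightarrow> zigzag_boundary (Suc q) b a u"
proof
  assume "zigzag_boundary q (Suc b) a w"
  then obtain y y' where y: "y \<in> K (Suc b) UNIV (Suc q) a" and y': "y' \<in> K (Suc (Suc b)) UNIV q a"
    and eq: "\<And>G. w G = koszul fscale y G + d (Suc b) (y' G)"
    unfolding zigzag_boundary_def by blast
  define z where "z = (\<lambda>G. u G - d b (y G))"
  have z: "z \<in> K b UNIV (Suc q) a" unfolding z_def by (rule free.chains_diff[OF u chains_d[OF y]])
  have "koszul fscale z G = 0" for G
    unfolding z_def using d_d[OF chain_free_mod[OF y'], of G]
    by (simp add: free.koszul_diff koszul_d d.add eq flip: wu)
  with z obtain x where "x \<in> K b UNIV (Suc (Suc q)) a" "\<And>G. koszul fscale x G = z G"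
    by (rule koszul_free_exact) blast
  then show "zigzag_boundary (Suc q) b a u"
    unfolding zigzag_boundary_def using y by (intro bexI[of _ x] bexI[of _ y]) (auto simp: z_def)
next
  assume "zigzag_boundary (Suc q) b a u"
  then obtain y y' where y: "y \<in> K b UNIV (Suc (Suc q)) a" and y': "y' \<in> K (Suc b) UNIV (Suc q) a"
    and eq: "\<And>G. u G = koszul fscale y G + d b (y' G)"
    unfolding zigzag_boundary_def by blast
  define z where "z = (\<lambda>G. w G - koszul fscale y' G)"
  have z: "z \<in> K (Suc b) UNIV q a"
    unfolding z_def by (rule free.chains_diff[OF w free.koszul_in_chains[OF y']])
  have "koszul fscale u G = koszul fscale (\<lambda>G. d b (y' G)) G" for G
  proof -
    have "koszul fscale (\<lambda>G. u G - d b (y' G)) G = koszul fscale (koszul fscale y) G"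
      by (simp add: eq)
    then show ?thesis by (simp only: free.koszul_diff free.koszul_koszul) simp
  qed
  then have "d b (z G) = 0" for G
    unfolding z_def by (simp add: d.diff wu koszul_d)
  with z obtain x where "x \<in> K (Suc (Suc b)) UNIV q a" "\<And>G. d (Suc b) (x G) = z G"
    by (rule chains_lift_Suc) blast
  then show "zigzag_boundary q (Suc b) a w"
    unfolding zigzag_boundary_def using y' by (intro bexI[of _ y'] bexI[of _ x]) (auto simp: z_def)
qed

text \<open>A cycle w is matched with any u whose Koszul differential is d w. Such a u is part of
  what a cycle is, and conversely w comes from exactness of the resolution. Both bound or neither
  does, so no map between quotients has to be built.\<close>

lemma zigzag_step:
  "(\<exists>w. zigzag_cycle q (Suc b) a w \<and> \<not> zigzag_boundary q (Suc b) a w) \<longleftrightarrow>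
   (\<exists>u. zigzag_cycle (Suc q) b a u \<and> \<not> zigzag_boundary (Suc q) b a u)"
proof safe
  fix w assume "zigzag_cycle q (Suc b) a w" and nb: "\<not> zigzag_boundary q (Suc b) a w"
  then obtain u where w: "w \<in> K (Suc b) UNIV q a" and u: "u \<in> K b UNIV (Suc q) a"
    and wu: "\<And>G. d b (w G) = koszul fscale u G"
    unfolding zigzag_cycle_def by auto
  have "zigzag_cycle (Suc q) b a u"
  proof (cases b)
    case 0
    then show ?thesis
      using u e_d[OF chain_free_mod[OF w[unfolded 0]]] by (simp add: zigzag_cycle_def flip: wu)
  next
    case (Suc c)
    have "(\<lambda>G. d c (u G)) \<in> K c UNIV (Suc q) a" using u chains_d Suc by simp
    moreover have "koszul fscale (\<lambda>G. d c (u G)) G = 0" for G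
      using d_d[OF chain_free_mod[OF w[unfolded Suc]]] by (simp add: koszul_d Suc flip: wu)
    ultimately obtain x where "x \<in> K c UNIV (Suc (Suc q)) a" "\<And>G. koszul fscale x G = d c (u G)"
      by (rule koszul_free_exact) blast
    then show ?thesis using u by (auto simp: zigzag_cycle_def Suc intro!: bexI[of _ x])
  qed
  then show "\<exists>u. zigzag_cycle (Suc q) b a u \<and> \<not> zigzag_boundary (Suc q) b a u"
    using nb zigzag_boundary_step[OF w u wu] by blast
next
  fix u assume cyc: "zigzag_cycle (Suc q) b a u" and nb: "\<not> zigzag_boundary (Suc q) b a u"
  then have u: "u \<in> K b UNIV (Suc q) a" by (simp add: zigzag_cycle_def)
  have ku: "koszul fscale u \<in> K b UNIV q a" by (rule free.koszul_in_chains[OF u])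
  obtain w where w: "w \<in> K (Suc b) UNIV q a" and wu: "\<And>G. d b (w G) = koszul fscale u G"
  proof (cases b)
    case 0
    then have "e (koszul fscale u G) = 0" for G using cyc by (simp add: zigzag_cycle_def)
    from chains_lift_0[OF ku[unfolded 0] this] show ?thesis using that 0 by blast
  next
    case (Suc c)
    then obtain x where "\<And>G. d c (u G) = koszul fscale x G"
      using cyc by (auto simp: zigzag_cycle_def)
    then have "d c (koszul fscale u G) = 0" for G
      by (simp add: free.koszul_koszul flip: koszul_d)
    from chains_lift_Suc[OF ku[unfolded Suc] this] show ?thesis using that Suc by blast
  qed
  then have "zigzag_cycle q (Suc b) a w" using u by (auto simp: zigzag_cycle_def)
  then show "\<exists>w. zigzag_cycle q (Suc b) a w \<and> \<not> zigzag_boundary q (Suc b) a w"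
    using nb zigzag_boundary_step[OF w u wu] by blast
qed

lemma zigzag:
  "(\<exists>w. zigzag_cycle q b a w \<and> \<not> zigzag_boundary q b a w) \<longleftrightarrow>
   (\<exists>u. zigzag_cycle (q + b) 0 a u \<and> \<not> zigzag_boundary (q + b) 0 a u)"
  by (induction b arbitrary: q) (simp_all add: zigzag_step)

end

section \<open>The product of the maximal ideal with a free module\<close>

lemma lookup_mult_zero:
  fixes q r :: "('n, 'k::semiring_0) mpoly"
  assumes "Poly_Mapping.lookup q 0 = 0 \<or> Poly_Mapping.lookup r 0 = 0"
  shows "Poly_Mapping.lookup (q * r) 0 = 0"
proof (rule ccontr)
  assume "Poly_Mapping.lookup (q * r) 0 \<noteq> 0"
  then have "0 \<in> Poly_Mapping.keys (q * r)" by (simp add: in_keys_iff)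
  then obtain s t where st: "0 = s + t" "s \<in> Poly_Mapping.keys q" "t \<in> Poly_Mapping.keys r"
    using keys_mult[of q r] by blast
  have "Poly_Mapping.lookup s l = 0" "Poly_Mapping.lookup t l = 0" for l
    using arg_cong[OF st(1), of "\<lambda>u. Poly_Mapping.lookup u l"] by (simp_all add: lookup_add)
  then have "s = 0" "t = 0" by (auto intro: poly_mapping_eqI)
  then show False using assms st by (simp add: in_keys_iff)
qed

text \<open>An element as a chain of homological degree 0, where the empty set is the only basis
  element.\<close>

definition point_chain :: "'m::zero \<Rightarrow> 'n set \<Rightarrow> 'm" where
  "point_chain v = (\<lambda>G. if G = {} then v else 0)"

lemma koszul_point_chain: "koszul fscale (point_chain v) G = 0"
  unfolding koszul_def point_chain_def by (intro sum.neutral) (simp add: fvec_eqI lookup_fscale)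

lemma (in graded_family) chains_0_iff:
  "w \<in> koszul_chains gr V 0 a \<longleftrightarrow> (\<exists>v\<in>gr a. w = point_chain v)" for w :: "'n set \<Rightarrow> 'm"
proof
  assume w: "w \<in> koszul_chains gr V 0 a"
  have "w = point_chain (w {})"
    using koszul_chainsD(3)[OF w] by (auto simp: point_chain_def fun_eq_iff)
  then show "\<exists>v\<in>gr a. w = point_chain v" using koszul_chainsD(1)[OF w, of "{}"] by auto
qed (auto simp: koszul_chains_def point_chain_def gr_zero split: if_splits)

lemma koszul_image_irrelevant:
  assumes "v = koszul fscale y {}" and "y \<in> koszul_chains (free_gr D) UNIV (Suc 0) a"
  shows "v \<in> irrelevant_free D"
proof -
  interpret module "fscale :: ('a, 'b) mpoly \<Rightarrow> _" by (rule module_fscale)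
  show ?thesis
    unfolding assms(1) koszul_def irrelevant_free_def
  proof (rule span_sum, rule span_base)
    fix i :: 'a
    have "linear_term i (koszul_sign i {}) \<in> (irrelevant_ideal :: ('a, 'b) mpoly set)"
      unfolding irrelevant_ideal_def by (auto simp: lookup_single when_def simp del: One_nat_def)
        (metis lookup_single_eq lookup_zero zero_neq_one)
    moreover have "y {i} \<in> free_mod D"
      using koszul_chainsD(1)[OF assms(2)] free_gr_subset_free_mod by blast
    ultimately show "fscale (linear_term i (koszul_sign i {})) (y {i})
        \<in> {fscale q v |q v. q \<in> irrelevant_ideal \<and> v \<in> free_mod D}"
      by blast
  qed
qed

lemma irrelevant_free_coeff:
  assumes "v \<in> irrelevant_free D"
  shows "v \<in> free_mod D" and "Poly_Mapping.lookup (Poly_Mapping.lookup v r) 0 = 0"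
proof -
  interpret module "fscale :: ('a, 'b) mpoly \<Rightarrow> _" by (rule module_fscale)
  define T where "T = {v \<in> free_mod D. \<forall>r. Poly_Mapping.lookup (Poly_Mapping.lookup v r) 0 = (0::'b)}"
  have "irrelevant_free D \<subseteq> T"
    unfolding irrelevant_free_def
  proof (rule span_minimal)
    show "{fscale q v |q v. q \<in> irrelevant_ideal \<and> v \<in> free_mod D} \<subseteq> T"
      by (auto simp: T_def free_mod_iff lookup_fscale irrelevant_ideal_def lookup_mult_zero)
    show "subspace T"
      by (rule subspaceI) (auto simp: T_def free_mod_iff lookup_fscale lookup_add lookup_mult_zero)
  qed
  then show "v \<in> free_mod D" "Poly_Mapping.lookup (Poly_Mapping.lookup v r) 0 = 0"
    using assms by (auto simp: T_def)
qed

text \<open>A monomial other than 1 involves some variable j, and this j is the direction that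
  \<open>koszul_free_exact_general\<close> asks for.\<close>

lemma exists_koszul_preimage:
  fixes v :: "('n::finite, 'k::field) fvec"
  assumes v: "v \<in> free_gr D a" and coeff: "\<And>r. Poly_Mapping.lookup (Poly_Mapping.lookup v r) 0 = 0"
  obtains y where "y \<in> koszul_chains (free_gr D) UNIV (Suc 0) a" "\<And>G. koszul fscale y G = point_chain v G"
proof (rule koszul_free_exact_general)
  show "point_chain v \<in> koszul_chains (free_gr D) UNIV 0 a"
    using v graded_family.chains_0_iff[OF graded_family_free] by blast
  show "koszul fscale (point_chain v) G = 0" for G by (rule koszul_point_chain)
  fix r t and G :: "'n set"
  assume rt: "r < length D" "t \<in> Poly_Mapping.keys (Poly_Mapping.lookup (point_chain v G) r)"
  then have G: "G = {}" and t: "t \<in> Poly_Mapping.keys (Poly_Mapping.lookup v r)"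
    by (auto simp: point_chain_def split: if_splits)
  then have "t \<noteq> 0" using coeff by (auto simp: in_keys_iff)
  then obtain j where "Poly_Mapping.lookup t j \<noteq> 0" using poly_mapping_eqI[of t 0] by auto
  moreover have "shift t (D ! r) = a" using v rt(1) t by (simp add: free_gr_iff)
  ultimately show "\<exists>j\<in>UNIV. (D ! r) j < a j"
    by (intro bexI[of _ j]) (auto simp: shift_def)
qed (rule that)

text \<open>If the constant coefficients vanish, each homogeneous component is a Koszul image, hence
  a combination of variables times elements of the free module.\<close>

lemma irrelevant_free_iff:
  fixes v :: "('n::finite, 'k::field) fvec"
  shows "v \<in> irrelevant_free D \<longleftrightarrow> v \<in> free_mod D \<and> (\<forall>r. Poly_Mapping.lookup (Poly_Mapping.lookup v r) 0 = 0)"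
proof
  assume v: "v \<in> free_mod D \<and> (\<forall>r. Poly_Mapping.lookup (Poly_Mapping.lookup v r) 0 = 0)"
  interpret module "fscale :: ('n, 'k) mpoly \<Rightarrow> _" by (rule module_fscale)
  have "component D a v \<in> irrelevant_free D" for a
  proof (rule exists_koszul_preimage[OF component_in_free_gr])
    fix y assume y: "y \<in> koszul_chains (free_gr D) UNIV (Suc 0) a"
      "\<And>G. koszul fscale y G = point_chain (component D a v) G"
    have "component D a v = koszul fscale y {}" by (simp add: y(2) point_chain_def)
    then show "component D a v \<in> irrelevant_free D" using y(1) by (rule koszul_image_irrelevant)
  qed (use v in \<open>simp add: lookup_component\<close>)
  then have "(\<Sum>a\<in>degrees D v. component D a v) \<in> irrelevant_free D"
    unfolding irrelevant_free_def by (rule span_sum)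
  then show "v \<in> irrelevant_free D" using v by (simp add: component_sum_degrees)
qed (use irrelevant_free_coeff in blast)

text \<open>Puts the conditions in \<open>tor_cycles\<close> and \<open>tor_boundaries\<close> into
  the language of the staircase at its end q = 0.\<close>

lemma irrelevant_free_iff_koszul:
  fixes v :: "('n::finite, 'k::field) fvec"
  assumes "v \<in> free_gr D a"
  shows "v \<in> irrelevant_free D \<longleftrightarrow>
    (\<exists>y\<in>koszul_chains (free_gr D) UNIV (Suc 0) a. \<forall>G. point_chain v G = koszul fscale y G)"
proof
  assume "v \<in> irrelevant_free D"
  then have "Poly_Mapping.lookup (Poly_Mapping.lookup v r) 0 = 0" for r by (simp add: irrelevant_free_iff)
  from exists_koszul_preimage[OF assms this]
  show "\<exists>y\<in>koszul_chains (free_gr D) UNIV (Suc 0) a. \<forall>G. point_chain v G = koszul fscale y G" by metis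
next
  assume "\<exists>y\<in>koszul_chains (free_gr D) UNIV (Suc 0) a. \<forall>G. point_chain v G = koszul fscale y G"
  then obtain y where y: "y \<in> koszul_chains (free_gr D) UNIV (Suc 0) a"
    and eq: "\<forall>G. point_chain v G = koszul fscale y G" by blast
  have "v = koszul fscale y {}" using eq[rule_format, of "{}"] by (simp add: point_chain_def)
  then show "v \<in> irrelevant_free D" using y by (rule koszul_image_irrelevant)
qed

lemma component_irrelevant:
  fixes v :: "('n::finite, 'k::field) fvec"
  shows "v \<in> irrelevant_free D \<Longrightarrow> component D a v \<in> irrelevant_free D"
  using subsetD[OF free_gr_subset_free_mod component_in_free_gr[of D a v]]
  by (simp add: irrelevant_free_iff lookup_component)

lemma coarse_free_iff:
  fixes v :: "('n::finite, 'k::field) fvec"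
  shows "v \<in> coarse (free_gr D) j \<longleftrightarrow> v \<in> free_mod D \<and>
    (\<forall>r<length D. \<forall>t\<in>Poly_Mapping.keys (Poly_Mapping.lookup v r). total (shift t (D ! r)) = j)"
proof
  assume "v \<in> coarse (free_gr D) j"
  then obtain f where v: "v = (\<Sum>a\<in>Poly_Mapping.keys f. Poly_Mapping.lookup f a)"
    and f: "\<And>a. Poly_Mapping.lookup f a \<in> free_gr D a" "\<And>a. a \<in> Poly_Mapping.keys f \<Longrightarrow> total a = j"
    unfolding coarse_def by blast
  have "total (shift t (D ! r)) = j" if rt: "r < length D"
      "t \<in> Poly_Mapping.keys (Poly_Mapping.lookup v r)" for r t
  proof -
    have "t \<in> Poly_Mapping.keys (\<Sum>a\<in>Poly_Mapping.keys f. Poly_Mapping.lookup (Poly_Mapping.lookup f a) r)"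
      using rt(2) unfolding v lookup_sum .
    then obtain a where a: "a \<in> Poly_Mapping.keys f"
        "t \<in> Poly_Mapping.keys (Poly_Mapping.lookup (Poly_Mapping.lookup f a) r)"
      using subsetD[OF keys_sum] by fast
    then have "shift t (D ! r) = a" using f(1)[of a] rt(1) by (simp add: free_gr_iff)
    then show ?thesis using f(2) a(1) by simp
  qed
  moreover have "v \<in> free_mod D" using f(1) by (auto simp: v free_mod_iff lookup_sum free_gr_iff)
  ultimately show "v \<in> free_mod D \<and>
    (\<forall>r<length D. \<forall>t\<in>Poly_Mapping.keys (Poly_Mapping.lookup v r). total (shift t (D ! r)) = j)" by blast
next
  assume v: "v \<in> free_mod D \<and>
    (\<forall>r<length D. \<forall>t\<in>Poly_Mapping.keys (Poly_Mapping.lookup v r). total (shift t (D ! r)) = j)"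
  define f where "f = (\<Sum>a\<in>degrees D v. Poly_Mapping.single a (component D a v))"
  have f: "Poly_Mapping.lookup f a = (if a \<in> degrees D v then component D a v else 0)" for a
    by (simp add: f_def lookup_sum lookup_single when_def finite_degrees)
  have keys: "Poly_Mapping.keys f \<subseteq> degrees D v" by (auto simp: in_keys_iff f split: if_splits)
  have "(\<Sum>a\<in>Poly_Mapping.keys f. Poly_Mapping.lookup f a) = (\<Sum>a\<in>degrees D v. Poly_Mapping.lookup f a)"
    by (rule sum.mono_neutral_left) (use keys in \<open>auto simp: finite_degrees in_keys_iff\<close>)
  then have "v = (\<Sum>a\<in>Poly_Mapping.keys f. Poly_Mapping.lookup f a)"
    using v by (simp add: f component_sum_degrees)
  moreover have "Poly_Mapping.lookup f a \<in> free_gr D a" for a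
    using component_in_free_gr[of D a v] component_in_free_gr[of D a "0 :: ('n, 'k) fvec"] by (simp add: f)
  moreover have "total a = j" if "a \<in> Poly_Mapping.keys f" for a
    using that keys v by (auto simp: degrees_def)
  ultimately show "v \<in> coarse (free_gr D) j" unfolding coarse_def by blast
qed

lemma free_gr_subset_coarse: "v \<in> free_gr D a \<Longrightarrow> total a = j \<Longrightarrow> v \<in> coarse (free_gr D) j"
  using free_gr_subset_free_mod[of D a] by (auto simp: coarse_free_iff free_gr_iff)

context free_resolution
begin

lemma zigzag_cycle_0_iff:
  assumes v: "v \<in> free_gr (D i) a" and j: "total a = j"
  shows "zigzag_cycle 0 i a (point_chain v) \<longleftrightarrow> v \<in> tor_cycles D d i j"
proof -
  have chain: "point_chain v \<in> K i UNIV 0 a" using v free.chains_0_iff by blast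
  have co: "v \<in> coarse (free_gr (D i)) j" by (rule free_gr_subset_coarse[OF v j])
  show ?thesis
  proof (cases i)
    case 0
    then show ?thesis using chain co by (simp add: zigzag_cycle_def tor_cycles_def koszul_point_chain e.zero)
  next
    case (Suc c)
    have dv: "d c v \<in> free_gr (D c) a" using d_gr v Suc by blast
    have "d c (point_chain v G) = point_chain (d c v) G" for G :: "'n set" by (simp add: point_chain_def d.zero)
    then show ?thesis
      using chain co irrelevant_free_iff_koszul[OF dv] by (simp add: zigzag_cycle_def tor_cycles_def Suc)
  qed
qed

text \<open>Projecting a representation d w + u to degree a makes w and u homogeneous.\<close>

lemma tor_boundaries_iff:
  assumes v: "v \<in> free_gr (D i) a" and j: "total a = j"
  shows "v \<in> tor_boundaries D d i j \<longleftrightarrow>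
    (\<exists>w\<in>free_gr (D (Suc i)) a. \<exists>u\<in>free_gr (D i) a. u \<in> irrelevant_free (D i) \<and> v = d i w + u)"
proof
  assume "v \<in> tor_boundaries D d i j"
  then obtain w u where w: "w \<in> free_mod (D (Suc i))" and u: "u \<in> irrelevant_free (D i)" and eq: "v = d i w + u"
    unfolding tor_boundaries_def by (auto simp: coarse_free_iff)
  have "v = component (D i) a v" by (simp add: component_free_gr[OF v])
  also have "\<dots> = d i (component (D (Suc i)) a w) + component (D i) a u"
    by (simp add: eq component_add component_d[OF w])
  finally show "\<exists>w\<in>free_gr (D (Suc i)) a. \<exists>u\<in>free_gr (D i) a. u \<in> irrelevant_free (D i) \<and> v = d i w + u"
    using component_in_free_gr component_irrelevant[OF u] by blast
next
  assume "\<exists>w\<in>free_gr (D (Suc i)) a. \<exists>u\<in>free_gr (D i) a. u \<in> irrelevant_free (D i) \<and> v = d i w + u"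
  then show "v \<in> tor_boundaries D d i j"
    unfolding tor_boundaries_def using free_gr_subset_coarse j by blast
qed

lemma zigzag_boundary_0_iff:
  assumes v: "v \<in> free_gr (D i) a" and j: "total a = j"
  shows "zigzag_boundary 0 i a (point_chain v) \<longleftrightarrow> v \<in> tor_boundaries D d i j"
proof
  assume "zigzag_boundary 0 i a (point_chain v)"
  then obtain y y' where y: "y \<in> K i UNIV (Suc 0) a" and y': "y' \<in> K (Suc i) UNIV 0 a"
    and eq': "\<And>G. point_chain v G = koszul fscale y G + d i (y' G)"
    unfolding zigzag_boundary_def by blast
  obtain w where w: "w \<in> free_gr (D (Suc i)) a" and "y' = point_chain w"
    using y' free.chains_0_iff by blast
  then have eq: "\<And>G. point_chain v G = koszul fscale y G + d i (point_chain w G)"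
    using eq' by simp
  have "v = d i w + koszul fscale y {}"
    using eq[of "{}"] by (simp add: point_chain_def add.commute)
  moreover have "koszul fscale y {} \<in> free_gr (D i) a"
    using koszul_chainsD(1)[OF free.koszul_in_chains[OF y], of "{}"] by simp
  moreover have "koszul fscale y {} \<in> irrelevant_free (D i)"
    by (rule koszul_image_irrelevant[OF refl y])
  ultimately show "v \<in> tor_boundaries D d i j"
    using tor_boundaries_iff[OF v j] w by blast
next
  assume "v \<in> tor_boundaries D d i j"
  then obtain w u where w: "w \<in> free_gr (D (Suc i)) a" and u: "u \<in> free_gr (D i) a" "u \<in> irrelevant_free (D i)"
    and eq: "v = d i w + u"
    using tor_boundaries_iff[OF v j] by blast
  obtain y where y: "y \<in> K i UNIV (Suc 0) a" "\<And>G. point_chain u G = koszul fscale y G"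
    using irrelevant_free_iff_koszul[OF u(1)] u(2) by blast
  have "point_chain v G = koszul fscale y G + d i (point_chain w G)" for G
    unfolding y(2)[symmetric] by (simp add: point_chain_def eq d.zero)
  moreover have "point_chain w \<in> K (Suc i) UNIV 0 a" using w free.chains_0_iff by blast
  ultimately show "zigzag_boundary 0 i a (point_chain v)"
    unfolding zigzag_boundary_def using y(1) by blast
qed

end

section \<open>From the free modules to the resolved module\<close>

lemma (in zn_graded_module) graded_family: "graded_family scale gr"
  by unfold_locales (auto simp: gr_zero gr_add gr_scale)

text \<open>Both f and the one-term mapping with value x at a decompose x, so
  \<open>gr_direct\<close> identifies them.\<close>

lemma (in zn_graded_module) component_unique:
  assumes "finite A" and h: "\<And>b. b \<in> A \<Longrightarrow> h b \<in> gr b" and x: "x \<in> gr a" "x = (\<Sum>b\<in>A. h b)"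
  shows "x = (if a \<in> A then h a else 0)"
proof -
  define f where "f = (\<Sum>b\<in>A. Poly_Mapping.single b (h b))"
  have f: "Poly_Mapping.lookup f b = (if b \<in> A then h b else 0)" for b
    using assms(1) by (simp add: f_def lookup_sum lookup_single when_def)
  have "(\<Sum>b\<in>Poly_Mapping.keys f. Poly_Mapping.lookup f b) = (\<Sum>b\<in>A. Poly_Mapping.lookup f b)"
    by (rule sum.mono_neutral_left) (auto simp: assms(1) in_keys_iff f split: if_splits)
  then have "(\<forall>b. Poly_Mapping.lookup f b \<in> gr b) \<and> x = (\<Sum>b\<in>Poly_Mapping.keys f. Poly_Mapping.lookup f b)"
    using x(2) h by (simp add: f gr_zero)
  moreover have "(\<forall>b. Poly_Mapping.lookup (Poly_Mapping.single a x) b \<in> gr b) \<and>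
      x = (\<Sum>b\<in>Poly_Mapping.keys (Poly_Mapping.single a x). Poly_Mapping.lookup (Poly_Mapping.single a x) b)"
    using x(1) by (simp add: lookup_single when_def gr_zero)
  ultimately have "f = Poly_Mapping.single a x" using gr_direct[of x] by blast
  then show ?thesis using f[of a] by simp
qed

locale module_resolution = zn_graded_module scale gr + free_resolution scale gr D d e
  for scale :: "('n::finite, 'k::field) mpoly \<Rightarrow> 'm::ab_group_add \<Rightarrow> 'm" and gr D d e
begin

sublocale graded_family scale gr
  by (rule graded_family)

text \<open>Splitting an arbitrary preimage decomposes x homogeneously, and by uniqueness the part
  in degree a is x itself. If a does not occur, x is 0 and lifts to 0.\<close>

lemma lift_e:
  assumes "x \<in> gr a"
  shows "\<exists>v\<in>free_gr (D 0) a. e v = x"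
proof -
  obtain v where v: "v \<in> free_mod (D 0)" "x = e v" using e_onto by blast
  have "x = (\<Sum>b\<in>degrees (D 0) v. e (component (D 0) b v))"
    unfolding v(2) by (simp add: component_sum_degrees[OF v(1)] flip: e.sum)
  moreover have "e (component (D 0) b v) \<in> gr b" for b
    using e_gr component_in_free_gr by blast
  ultimately have "x = (if a \<in> degrees (D 0) v then e (component (D 0) a v) else 0)"
    using assms by (intro component_unique[OF finite_degrees])
  then show ?thesis
    using component_in_free_gr[of "D 0" a v] free.gr_zero[of 0 a] e.zero by (metis (full_types))
qed

definition koszul_cycle :: "nat \<Rightarrow> ('n \<Rightarrow> int) \<Rightarrow> ('n set \<Rightarrow> 'm) \<Rightarrow> bool" where
  "koszul_cycle q a z \<longleftrightarrow> z \<in> koszul_chains gr UNIV q a \<and> (\<forall>G. koszul scale z G = 0)"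

definition koszul_boundary :: "nat \<Rightarrow> ('n \<Rightarrow> int) \<Rightarrow> ('n set \<Rightarrow> 'm) \<Rightarrow> bool" where
  "koszul_boundary q a z \<longleftrightarrow> (\<exists>y\<in>koszul_chains gr UNIV (Suc q) a. \<forall>G. z G = koszul scale y G)"

lemma chains_lift_e:
  assumes "z \<in> koszul_chains gr V q a"
  obtains w where "w \<in> K 0 V q a" "\<And>G. e (w G) = z G"
  using chains_lift[OF graded_family_free e_hom assms lift_e] that by metis

text \<open>The last corner of the staircase, with \<open>e\<close> in the place of a
  differential.\<close>

lemma zigzag_boundary_iff_koszul:
  assumes w: "w \<in> K 0 UNIV q a"
  shows "zigzag_boundary q 0 a w \<longleftrightarrow> koszul_boundary q a (\<lambda>G. e (w G))"
proof
  assume "zigzag_boundary q 0 a w"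
  then obtain y y' where y: "y \<in> K 0 UNIV (Suc q) a" and y': "y' \<in> K (Suc 0) UNIV q a"
    and eq: "\<And>G. w G = koszul fscale y G + d 0 (y' G)"
    unfolding zigzag_boundary_def by blast
  have "e (w G) = koszul scale (\<lambda>G. e (y G)) G" for G
    using e_d[OF chain_free_mod[OF y']] by (simp add: eq e.add koszul_e)
  then show "koszul_boundary q a (\<lambda>G. e (w G))"
    unfolding koszul_boundary_def using chains_e[OF y] by blast
next
  assume "koszul_boundary q a (\<lambda>G. e (w G))"
  then obtain x where x: "x \<in> koszul_chains gr UNIV (Suc q) a" "\<And>G. e (w G) = koszul scale x G"
    unfolding koszul_boundary_def by blast
  obtain y where y: "y \<in> K 0 UNIV (Suc q) a" "\<And>G. e (y G) = x G" using chains_lift_e[OF x(1)] by blast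
  define z where "z = (\<lambda>G. w G - koszul fscale y G)"
  have z: "z \<in> K 0 UNIV q a" unfolding z_def by (rule free.chains_diff[OF w free.koszul_in_chains[OF y(1)]])
  have "(\<lambda>G. e (y G)) = x" using y(2) by auto
  then have "e (z G) = 0" for G
    using koszul_e[of y G] by (simp add: z_def e.diff x(2))
  with z obtain y' where "y' \<in> K (Suc 0) UNIV q a" "\<And>G. d 0 (y' G) = z G"
    by (rule chains_lift_0) blast
  then show "zigzag_boundary q 0 a w"
    unfolding zigzag_boundary_def using y by (intro bexI[of _ y] bexI[of _ y']) (auto simp: z_def)
qed

lemma zigzag_cycle_iff_koszul:
  "zigzag_cycle q 0 a w \<longleftrightarrow> w \<in> K 0 UNIV q a \<and> koszul_cycle q a (\<lambda>G. e (w G))"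
  using chains_e[of w UNIV q a] by (auto simp: zigzag_cycle_def koszul_cycle_def koszul_e)

text \<open>The staircase runs from (0, i) to (i, 0): point chains identify its first end with Tor,
  and \<open>e\<close> carries its last end to M.\<close>

theorem tor_nonzero_iff_koszul:
  assumes j: "total a = j"
  shows "(\<exists>v\<in>free_gr (D i) a. v \<in> tor_cycles D d i j \<and> v \<notin> tor_boundaries D d i j) \<longleftrightarrow>
    (\<exists>z. koszul_cycle i a z \<and> \<not> koszul_boundary i a z)"
proof -
  have "(\<exists>v\<in>free_gr (D i) a. v \<in> tor_cycles D d i j \<and> v \<notin> tor_boundaries D d i j) \<longleftrightarrow>
      (\<exists>v\<in>free_gr (D i) a. zigzag_cycle 0 i a (point_chain v) \<and> \<not> zigzag_boundary 0 i a (point_chain v))"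
    using zigzag_cycle_0_iff[OF _ j] zigzag_boundary_0_iff[OF _ j] by blast
  also have "\<dots> \<longleftrightarrow> (\<exists>w. zigzag_cycle 0 i a w \<and> \<not> zigzag_boundary 0 i a w)"
    unfolding zigzag_cycle_def free.chains_0_iff by blast
  also have "\<dots> \<longleftrightarrow> (\<exists>w. zigzag_cycle i 0 a w \<and> \<not> zigzag_boundary i 0 a w)"
    using zigzag[of 0 i a] by simp
  also have "\<dots> \<longleftrightarrow> (\<exists>z. koszul_cycle i a z \<and> \<not> koszul_boundary i a z)"
  proof safe
    fix w assume "zigzag_cycle i 0 a w" "\<not> zigzag_boundary i 0 a w"
    then show "\<exists>z. koszul_cycle i a z \<and> \<not> koszul_boundary i a z"
      using zigzag_cycle_iff_koszul zigzag_boundary_iff_koszul by blast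
  next
    fix z assume z: "koszul_cycle i a z" "\<not> koszul_boundary i a z"
    obtain w where w: "w \<in> K 0 UNIV i a" "\<And>G. e (w G) = z G"
      using z(1) chains_lift_e unfolding koszul_cycle_def by blast
    then have "(\<lambda>G. e (w G)) = z" by auto
    then show "\<exists>w. zigzag_cycle i 0 a w \<and> \<not> zigzag_boundary i 0 a w"
      using w(1) z zigzag_cycle_iff_koszul zigzag_boundary_iff_koszul by metis
  qed
  finally show ?thesis .
qed

end

section \<open>Dimension of Tor\<close>

text \<open>\<open>dim\<close> is a cardinality and would be 0 for an infinite basis, hence the
  finite spanning set.\<close>

lemma (in vector_space) dim_mono_finite_span:
  assumes "U \<subseteq> W" "W \<subseteq> span S" "finite S"
  shows "dim U \<le> dim W"
proof -
  obtain B where B: "B \<subseteq> W" "independent B" "W \<subseteq> span B" "card B = dim W"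
    using basis_exists by blast
  have "finite B" using independent_span_bound[OF assms(3) B(2)] B(1) assms(2) by blast
  then show ?thesis using dim_le_card[of U B] B assms(1) by auto
qed

text \<open>The operators \<open>\<pi> a\<close> play the role of the projections onto homogeneous components.\<close>

lemma (in vector_space) dim_add_card_le:
  assumes UW: "U \<subseteq> W" and W: "W \<subseteq> span S" "finite S" and U: "subspace U" and A: "finite A"
    and add: "\<And>a x y. \<pi> a (x + y) = \<pi> a x + \<pi> a y" and scale: "\<And>a c x. \<pi> a (scale c x) = scale c (\<pi> a x)"
    and stable: "\<And>a x. x \<in> U \<Longrightarrow> \<pi> a x \<in> U"
    and v: "\<And>a. a \<in> A \<Longrightarrow> v a \<in> W" "\<And>a. a \<in> A \<Longrightarrow> v a \<notin> U"
    and eigen: "\<And>a b. b \<in> A \<Longrightarrow> \<pi> a (v b) = (if a = b then v b else 0)"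
  shows "dim U + card A \<le> dim W"
proof -
  obtain B where B: "B \<subseteq> U" "independent B" "U \<subseteq> span B" "card B = dim U"
    using basis_exists by blast
  have finB: "finite B" using independent_span_bound[OF W(2) B(2)] B(1) UW W(1) by blast
  have pi0: "\<pi> a 0 = 0" for a using add[of a 0 0] by simp
  have "independent (B \<union> v ` A') \<and> card (B \<union> v ` A') = dim U + card A'" if "A' \<subseteq> A" for A'
    using finite_subset[OF that A] that
  proof (induction A' rule: finite_induct)
    case empty
    then show ?case using B by simp
  next
    case (insert a A')
    \<comment> \<open>\<open>\<pi> a\<close> sends B and the earlier vectors into U, whereas it
      fixes \<open>v a\<close>, which lies outside U. So \<open>v a\<close> is independent of
      them.\<close>
    have "span (B \<union> v ` A') \<subseteq> {x. \<pi> a x \<in> U}"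
    proof (rule span_minimal)
      show "B \<union> v ` A' \<subseteq> {x. \<pi> a x \<in> U}"
        using B(1) stable eigen insert subspace_0[OF U] by auto
      show "subspace {x. \<pi> a x \<in> U}"
        using subspace_0[OF U] subspace_add[OF U] subspace_scale[OF U]
            by (intro subspaceI) (simp_all add: add scale pi0)
    qed
    moreover have "\<pi> a (v a) \<notin> U" using v(2) eigen insert.prems by simp
    ultimately have notin: "v a \<notin> span (B \<union> v ` A')" by blast
    then have "v a \<notin> B \<union> v ` A'" using span_base[of "v a" "B \<union> v ` A'"] by argo
    then have "card (insert (v a) (B \<union> v ` A')) = Suc (card (B \<union> v ` A'))"
      using finB insert.hyps(1) by (intro card_insert_disjoint) simp_all
    moreover have "independent (insert (v a) (B \<union> v ` A'))"
      using insert.IH insert.prems by (intro independent_insertI[OF notin]) simp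
    ultimately show ?case using insert.IH insert.prems insert.hyps by simp
  qed
  then have C: "independent (B \<union> v ` A)" "card (B \<union> v ` A) = dim U + card A" by auto
  have "B \<union> v ` A \<subseteq> W" using B(1) UW v(1) by blast
  from maximal_independent_subset_extend[OF this C(1)] obtain B'
    where B': "B \<union> v ` A \<subseteq> B'" "B' \<subseteq> W" "independent B'" "W \<subseteq> span B'" by blast
  have "finite B'" using independent_span_bound[OF W(2) B'(3)] B'(2) W(1) by blast
  then have "card (B \<union> v ` A) \<le> card B'" using B'(1) card_mono by blast
  also have "card B' = dim W" using basis_card_eq_dim B' by blast
  finally show ?thesis using C(2) by simp
qed

lemma finite_total_shift: "finite {t :: 'n::finite \<Rightarrow>\<^sub>0 nat. total (shift t a) = j}"
proof -
  have "inj_on Poly_Mapping.lookup {t :: 'n \<Rightarrow>\<^sub>0 nat. total (shift t a) = j}"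
    by (simp add: inj_on_def)
  moreover have "Poly_Mapping.lookup ` {t :: 'n \<Rightarrow>\<^sub>0 nat. total (shift t a) = j} \<subseteq>
      {f. \<forall>x. (x \<in> UNIV \<longrightarrow> f x \<in> {..nat (j - total a)}) \<and> (x \<notin> UNIV \<longrightarrow> f x = 0)}"
  proof clarsimp
    fix t :: "'n \<Rightarrow>\<^sub>0 nat" and x
    have "int (Poly_Mapping.lookup t x) \<le> (\<Sum>l\<in>UNIV. int (Poly_Mapping.lookup t l))"
      by (rule member_le_sum) auto
    then show "Poly_Mapping.lookup t x \<le> nat (total (shift t a) - total a)"
      by (simp add: total_def shift_def sum.distrib)
  qed
  then have "finite (Poly_Mapping.lookup ` {t :: 'n \<Rightarrow>\<^sub>0 nat. total (shift t a) = j})"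
    by (rule finite_subset) (intro finite_set_of_finite_funs; simp)
  ultimately show ?thesis using finite_imageD by blast
qed

lemma coarse_free_iff_lookup:
  fixes v :: "('n::finite, 'k::field) fvec"
  shows "v \<in> coarse (free_gr D) j \<longleftrightarrow> (\<forall>r t. Poly_Mapping.lookup (Poly_Mapping.lookup v r) t \<noteq> 0 \<longrightarrow>
    r < length D \<and> total (shift t (D ! r)) = j)"
  unfolding coarse_free_iff free_mod_iff
proof safe
  fix r t
  assume 1: "\<forall>r\<ge>length D. Poly_Mapping.lookup v r = 0"
    and 2: "\<forall>r<length D. \<forall>t\<in>Poly_Mapping.keys (Poly_Mapping.lookup v r). total (shift t (D ! r)) = j"
    and nz: "Poly_Mapping.lookup (Poly_Mapping.lookup v r) t \<noteq> 0"
  show r: "r < length D" using 1 nz by (metis leI lookup_zero)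
  show "total (shift t (D ! r)) = j" using 2 r nz by (simp add: in_keys_iff)
next
  fix r
  assume "\<forall>r t. Poly_Mapping.lookup (Poly_Mapping.lookup v r) t \<noteq> 0 \<longrightarrow>
      r < length D \<and> total (shift t (D ! r)) = j" "length D \<le> r"
  then show "Poly_Mapping.lookup v r = 0" by (intro poly_mapping_eqI) (metis leD lookup_zero)
qed (simp add: in_keys_iff)

text \<open>Only finitely many monomials have a given total degree. This finiteness is what the
  comparisons of \<open>kdim\<close> rest on.\<close>

lemma coarse_free_finite_span:
  obtains S :: "('n::finite, 'k::field) fvec set"
  where "finite S" "coarse (free_gr D) j \<subseteq> module.span (\<lambda>c::'k. fscale (const c)) S"
proof
  interpret vs: vector_space "\<lambda>c::'k. fscale (const c :: ('n, 'k) mpoly)"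
    by (rule vector_space_fscale_const)
  define b where "b = (\<lambda>r t. Poly_Mapping.single r (Poly_Mapping.single t 1) :: ('n, 'k) fvec)"
  define S where "S = (\<Union>r<length D. b r ` {t. total (shift t (D ! r)) = j})"
  show "finite S" unfolding S_def by (simp add: finite_total_shift)
  show "coarse (free_gr D) j \<subseteq> vs.span S"
  proof
    fix v :: "('n, 'k) fvec" assume v: "v \<in> coarse (free_gr D) j"
    let ?c = "\<lambda>r t. Poly_Mapping.lookup (Poly_Mapping.lookup v r) t"
    have b: "Poly_Mapping.lookup (Poly_Mapping.lookup (fscale (const c) (b r t)) r') t' =
        (if r = r' then if t = t' then c else 0 else 0)" for c r t r' t'
      by (simp add: lookup_fscale lookup_const_times b_def lookup_single when_def)
    have "v = (\<Sum>r<length D. \<Sum>t\<in>Poly_Mapping.keys (Poly_Mapping.lookup v r). fscale (const (?c r t)) (b r t))"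
    proof (rule fvec_eqI)
      fix r t
      have "Poly_Mapping.lookup (Poly_Mapping.lookup
          (\<Sum>r<length D. \<Sum>t\<in>Poly_Mapping.keys (Poly_Mapping.lookup v r). fscale (const (?c r t)) (b r t)) r) t
        = (\<Sum>r'<length D. if r' = r then \<Sum>t'\<in>Poly_Mapping.keys (Poly_Mapping.lookup v r').
            if t' = t then ?c r' t' else 0 else 0)"
        unfolding lookup_sum b by (intro sum.cong refl) (simp del: sum.delta sum.delta')
      also have "\<dots> = ?c r t"
        using v unfolding coarse_free_iff_lookup by (auto simp: in_keys_iff)
      finally show "?c r t = Poly_Mapping.lookup (Poly_Mapping.lookup
          (\<Sum>r<length D. \<Sum>t\<in>Poly_Mapping.keys (Poly_Mapping.lookup v r). fscale (const (?c r t)) (b r t)) r) t"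
        by simp
    qed
    also have "\<dots> \<in> vs.span S"
    proof (intro vs.span_sum vs.span_scale vs.span_base)
      fix r t assume "r \<in> {..<length D}" "t \<in> Poly_Mapping.keys (Poly_Mapping.lookup v r)"
      then show "b r t \<in> S" using v by (auto simp: S_def coarse_free_iff)
    qed
    finally show "v \<in> vs.span S" .
  qed
qed

section \<open>Bounding Tor by the number of its multidegrees\<close>

context free_resolution
begin

interpretation vs: vector_space "\<lambda>c::'k. fscale (const c :: ('n, 'k) mpoly)"
  by (rule vector_space_fscale_const)

lemma subspace_coarse_free: "vs.subspace (coarse (free_gr E) j)"
proof (rule vs.subspaceI)
  fix x y :: "('n, 'k) fvec" assume xy: "x \<in> coarse (free_gr E) j" "y \<in> coarse (free_gr E) j"
  show "x + y \<in> coarse (free_gr E) j"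
    unfolding coarse_free_iff_lookup
  proof (intro allI impI)
    fix r t assume "Poly_Mapping.lookup (Poly_Mapping.lookup (x + y) r) t \<noteq> 0"
    then have "Poly_Mapping.lookup (Poly_Mapping.lookup x r) t \<noteq> 0 \<or> Poly_Mapping.lookup
        (Poly_Mapping.lookup y r) t \<noteq> 0"
      by (auto simp: lookup_add)
    then show "r < length E \<and> total (shift t (E ! r)) = j" using xy unfolding coarse_free_iff_lookup by blast
  qed
qed (auto simp: coarse_free_iff_lookup lookup_fscale lookup_const_times)

lemma subspace_irrelevant_free: "vs.subspace (irrelevant_free E)"
  by (rule vs.subspaceI) (auto
      simp: irrelevant_free_iff free_mod_iff lookup_add lookup_fscale lookup_const_times)

lemma component_coarse: "v \<in> coarse (free_gr E) j \<Longrightarrow> component E a v \<in> coarse (free_gr E) (j :: int)"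
  for v :: "('n, 'k) fvec"
  by (auto simp: coarse_free_iff_lookup lookup_component)

lemma coarse_free_mod: "v \<in> coarse (free_gr E) j \<Longrightarrow> v \<in> free_mod E"
  for v :: "('n, 'k) fvec"
  by (simp add: coarse_free_iff)

lemma d_coarse:
  assumes "w \<in> coarse (free_gr (D (Suc i))) j"
  shows "d i w \<in> coarse (free_gr (D i)) j"
proof -
  have w: "w \<in> free_mod (D (Suc i))" using assms by (rule coarse_free_mod)
  have "d i (component (D (Suc i)) a w) \<in> coarse (free_gr (D i)) j" if "a \<in> degrees (D (Suc i)) w" for a
  proof (rule free_gr_subset_coarse)
    show "d i (component (D (Suc i)) a w) \<in> free_gr (D i) a" using d_gr component_in_free_gr by blast
    show "total a = j" using that assms by (auto simp: degrees_def coarse_free_iff)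
  qed
  then have "(\<Sum>a\<in>degrees (D (Suc i)) w. d i (component (D (Suc i)) a w)) \<in> coarse (free_gr (D i)) j"
    by (rule vs.subspace_sum[OF subspace_coarse_free])
  then show ?thesis by (simp add: component_sum_degrees[OF w] flip: d.sum)
qed

lemma d_const_hom: "module_hom (\<lambda>c::'k. fscale (const c)) (\<lambda>c::'k. fscale (const c)) (d i)"
  by (rule module_hom.intro) (unfold_locales, simp_all add: d.add d.scale)

lemma d_irrelevant:
  assumes "u \<in> irrelevant_free (D (Suc i))"
  shows "d i u \<in> irrelevant_free (D i)"
proof -
  have sub: "module.subspace fscale (irrelevant_free (D i) :: ('n, 'k) fvec set)"
    unfolding irrelevant_free_def by (rule module.subspace_span[OF module_fscale])
  have "irrelevant_free (D (Suc i)) \<subseteq> d i -` irrelevant_free (D i)"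
    unfolding irrelevant_free_def[of "D (Suc i)"]
  proof (rule module.span_minimal[OF module_fscale])
    show "{fscale q v |q v. q \<in> irrelevant_ideal \<and> v \<in> free_mod (D (Suc i))} \<subseteq> d i -` irrelevant_free (D i)"
    proof clarify
      fix q v assume "q \<in> (irrelevant_ideal :: ('n, 'k) mpoly set)"
          "v \<in> (free_mod (D (Suc i)) :: ('n, 'k) fvec set)"
      then have "fscale q (d i v) \<in> irrelevant_free (D i)"
        unfolding irrelevant_free_def using d_free_mod by (intro module.span_base[OF module_fscale]) blast
      then show "fscale q v \<in> d i -` irrelevant_free (D i)" by (simp add: d.scale)
    qed
    show "module.subspace fscale (d i -` irrelevant_free (D i))"
      by (rule d.subspace_vimage[OF sub])
  qed
  then show ?thesis using assms by blast
qed

lemma tor_boundaries_alt: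
  "tor_boundaries D d i j = {x + u | x u. x \<in> d i ` coarse (free_gr (D (Suc i))) j \<and>
     u \<in> irrelevant_free (D i) \<inter> coarse (free_gr (D i)) j}"
  unfolding tor_boundaries_def by blast

lemma subspace_tor_boundaries: "vs.subspace (tor_boundaries D d i j)"
  unfolding tor_boundaries_alt
proof (rule vs.subspace_sums)
  show "vs.subspace (irrelevant_free (D i) \<inter> coarse (free_gr (D i)) j)"
    by (rule vs.subspace_inter[OF subspace_irrelevant_free subspace_coarse_free])
  show "vs.subspace (d i ` coarse (free_gr (D (Suc i))) j)"
    by (rule module_hom.subspace_image[OF d_const_hom subspace_coarse_free])
qed

lemma tor_boundaries_subset_cycles: "tor_boundaries D d i j \<subseteq> tor_cycles D d i j"
proof
  fix v assume "v \<in> tor_boundaries D d i j"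
  then obtain w u where w: "w \<in> coarse (free_gr (D (Suc i))) j" and u: "u \<in> irrelevant_free (D i)"
      "u \<in> coarse (free_gr (D i)) j"
    and v: "v = d i w + u"
    unfolding tor_boundaries_def by blast
  have "v \<in> coarse (free_gr (D i)) j"
    unfolding v using vs.subspace_add[OF subspace_coarse_free d_coarse[OF w] u(2)] .
  moreover have "d l v \<in> irrelevant_free (D l)" if "i = Suc l" for l
  proof -
    have "d l (d i w) = 0" using d_d coarse_free_mod[OF w] that by simp
    then show ?thesis using d_irrelevant u(1) that by (simp add: v d.add)
  qed
  ultimately show "v \<in> tor_cycles D d i j" by (auto simp: tor_cycles_def split: nat.split)
qed

lemma component_tor_cycles:
  assumes "v \<in> tor_cycles D d i j"
  shows "component (D i) a v \<in> tor_cycles D d i j"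
proof -
  have v: "v \<in> coarse (free_gr (D i)) j" using assms by (simp add: tor_cycles_def)
  have "d l (component (D i) a v) \<in> irrelevant_free (D l)" if i: "i = Suc l" for l
  proof -
    have "d l v \<in> irrelevant_free (D l)" using assms i by (simp add: tor_cycles_def)
    then show ?thesis
      using component_irrelevant component_d coarse_free_mod[OF v] i by metis
  qed
  then show ?thesis using component_coarse[OF v] by (auto simp: tor_cycles_def split: nat.split)
qed

lemma component_tor_boundaries:
  assumes "v \<in> tor_boundaries D d i j"
  shows "component (D i) a v \<in> tor_boundaries D d i j"
proof -
  obtain w u where w: "w \<in> coarse (free_gr (D (Suc i))) j" and u: "u \<in> irrelevant_free (D i)"
      "u \<in> coarse (free_gr (D i)) j"
    and v: "v = d i w + u"
    using assms unfolding tor_boundaries_def by blast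
  have "component (D i) a v = d i (component (D (Suc i)) a w) + component (D i) a u"
    by (simp add: v component_add component_d[OF coarse_free_mod[OF w]])
  then show ?thesis
    unfolding tor_boundaries_def
        using component_coarse[OF w] component_coarse[OF u(2)] component_irrelevant[OF u(1)] by blast
qed

text \<open>The boundaries are stable under the projections to multidegrees, so non-boundaries in
  different multidegrees are independent modulo boundaries.\<close>

lemma card_le_tor_dim:
  assumes "finite A" and "\<And>a. a \<in> A \<Longrightarrow> total a = j"
    and "\<And>a. a \<in> A \<Longrightarrow> \<exists>v\<in>free_gr (D i) a. v \<in> tor_cycles D d i j \<and> v \<notin> tor_boundaries D d i j"
  shows "card A \<le> tor_dim D d i j"
proof -
  obtain v where v: "\<And>a. a \<in> A \<Longrightarrow> v a \<in> free_gr (D i) a"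
      "\<And>a. a \<in> A \<Longrightarrow> v a \<in> tor_cycles D d i j" "\<And>a. a \<in> A \<Longrightarrow> v a \<notin> tor_boundaries D d i j"
    using assms(3) by metis
  obtain S :: "('n, 'k) fvec set" where S: "finite S" "coarse (free_gr (D i)) j \<subseteq> vs.span S"
    by (rule coarse_free_finite_span)
  have "tor_cycles D d i j \<subseteq> vs.span S" using S(2) by (auto simp: tor_cycles_def)
  then have "vs.dim (tor_boundaries D d i j) + card A \<le> vs.dim (tor_cycles D d i j)"
  proof (rule vs.dim_add_card_le[OF tor_boundaries_subset_cycles _ S(1) subspace_tor_boundaries assms(1),
        where \<pi> = "component (D i)" and v = v])
    show "component (D i) a (v b) = (if a = b then v b else 0)" if "b \<in> A" for a b
      using component_free_gr[OF v(1)[OF that]] by simp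
  qed (simp_all add: component_add component_fscale_const component_tor_boundaries v)
  then show ?thesis by (simp add: tor_dim_def kdim_def)
qed

text \<open>If every homogeneous component of every cycle were a boundary, cycles and boundaries
  would coincide and the difference of dimensions would be 0.\<close>

lemma tor_dim_nonzero:
  assumes "tor_dim D d i j \<noteq> 0"
  obtains a v where "total a = j" "v \<in> free_gr (D i) a" "v \<in> tor_cycles D d i j" "v \<notin> tor_boundaries D d i j"
proof (rule ccontr)
  assume none: "\<not> thesis"
  obtain S :: "('n, 'k) fvec set" where S: "finite S" "coarse (free_gr (D i)) j \<subseteq> vs.span S"
    by (rule coarse_free_finite_span)
  have "tor_cycles D d i j \<subseteq> tor_boundaries D d i j"
  proof
    fix x assume x: "x \<in> tor_cycles D d i j"
    then have xc: "x \<in> coarse (free_gr (D i)) j" by (simp add: tor_cycles_def)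
    have "component (D i) a x \<in> tor_boundaries D d i j" if "a \<in> degrees (D i) x" for a
    proof -
      have "total a = j" using that xc by (auto simp: degrees_def coarse_free_iff)
      then show ?thesis using none that component_in_free_gr component_tor_cycles[OF x]
        \<open>\<And>a v. total a = j \<Longrightarrow> v \<in> free_gr (D i) a \<Longrightarrow> v \<in> tor_cycles D d i j \<Longrightarrow> v \<notin> tor_boundaries D d i j \<Longrightarrow> thesis\<close>
        by blast
    qed
    then have "(\<Sum>a\<in>degrees (D i) x. component (D i) a x) \<in> tor_boundaries D d i j"
      by (rule vs.subspace_sum[OF subspace_tor_boundaries])
    then show "x \<in> tor_boundaries D d i j" by (simp add: component_sum_degrees[OF coarse_free_mod[OF xc]])
  qed
  moreover have "tor_boundaries D d i j \<subseteq> vs.span S"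
    using tor_boundaries_subset_cycles S(2) by (force simp: tor_cycles_def)
  ultimately have "vs.dim (tor_cycles D d i j) \<le> vs.dim (tor_boundaries D d i j)"
    using vs.dim_mono_finite_span[OF _ _ S(1)] by blast
  then show False using assms by (simp add: tor_dim_def kdim_def)
qed

end

section \<open>Koszul homology of syzygy modules\<close>

context free_resolution
begin

text \<open>Membership in the kernel of the map leaving F_b; by exactness this kernel is the syzygy
  module of index b + 1.\<close>

definition in_kernel :: "nat \<Rightarrow> ('n, 'k) fvec \<Rightarrow> bool" where
  "in_kernel b v \<longleftrightarrow> (case b of 0 \<Rightarrow> e v = 0 | Suc c \<Rightarrow> d c v = 0)"

lemma in_kernel_iff: "v \<in> free_mod (D b) \<Longrightarrow> in_kernel b v \<longleftrightarrow> v \<in> d b ` free_mod (D (Suc b))"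
  by (cases b) (simp_all add: in_kernel_def exact_0 exact_Suc)

lemma chains_lift_kernel:
  assumes "z \<in> K b V q a" "\<And>G. in_kernel b (z G)"
  obtains w where "w \<in> K (Suc b) V q a" "\<And>G. d b (w G) = z G"
proof (cases b)
  case 0
  then show ?thesis using chains_lift_0[of z V q a] assms that by (auto simp: in_kernel_def)
next
  case (Suc c)
  then show ?thesis using chains_lift_Suc[of z c V q a] assms that by (auto simp: in_kernel_def)
qed

text \<open>Over F_b, z is the Koszul differential of some w. The obstruction to taking w in the
  syzygy module is d w, a cycle with coefficients in the preceding syzygy module and one degree
  higher. The sum of degree and b stays the same, and so does the bound on V.\<close>

lemma koszul_syzygy_exact:
  assumes "z \<in> K b V (Suc q) a" and "\<And>G. koszul fscale z G = 0" and "\<And>G. in_kernel b (z G)"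
    and "card V \<le> Suc q + b"
  shows "\<exists>w\<in>K b V (Suc (Suc q)) a. (\<forall>G. koszul fscale w G = z G) \<and> (\<forall>G. in_kernel b (w G))"
  using assms
proof (induction b arbitrary: q z)
  case (0 q z)
  obtain w where w: "w \<in> K 0 V (Suc (Suc q)) a" "\<And>G. koszul fscale w G = z G"
    using koszul_free_exact[OF "0.prems"(1,2)] by blast
  \<comment> \<open>V has at most q + 1 elements, hence no subset with q + 2.\<close>
  have "w G = 0" for G
  proof (rule ccontr)
    assume "w G \<noteq> 0"
    then have "G \<subseteq> V" "card G = Suc (Suc q)" using koszul_chainsD(2,3)[OF w(1)] by blast+
    then show False using "0.prems"(4) card_mono[of V G] by simp
  qed
  then have "in_kernel 0 (w G)" for G by (simp add: in_kernel_def e.zero)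
  then show ?case using w by blast
next
  case (Suc c q z)
  obtain w where w: "w \<in> K (Suc c) V (Suc (Suc q)) a" "\<And>G. koszul fscale w G = z G"
    using koszul_free_exact[OF Suc.prems(1,2)] by blast
  have x: "(\<lambda>G. d c (w G)) \<in> K c V (Suc (Suc q)) a" by (rule chains_d[OF w(1)])
  have "koszul fscale (\<lambda>G. d c (w G)) G = 0" for G
    using Suc.prems(3)[of G] by (simp add: koszul_d w(2) in_kernel_def)
  moreover have "in_kernel c (d c (w G))" for G
    using chain_free_mod[OF w(1), of G] in_kernel_iff[OF d_free_mod] by blast
  moreover have "card V \<le> Suc (Suc q) + c" using Suc.prems(4) by simp
  ultimately obtain u where u: "u \<in> K c V (Suc (Suc (Suc q))) a" "\<And>G. koszul fscale u G = d c (w G)"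
      "\<And>G. in_kernel c (u G)"
    using Suc.IH[OF x] by blast
  obtain y where y: "y \<in> K (Suc c) V (Suc (Suc (Suc q))) a" "\<And>G. d c (y G) = u G"
    using chains_lift_kernel[OF u(1,3)] by blast
  have uy: "(\<lambda>G. d c (y G)) = u" using y(2) by auto
  \<comment> \<open>The correction is a Koszul boundary, so z is still hit; and d sends it to the
    Koszul differential of u, which is d w, so d v = 0.\<close>
  define v where "v = (\<lambda>G. w G - koszul fscale y G)"
  have "v \<in> K (Suc c) V (Suc (Suc q)) a"
    unfolding v_def by (rule free.chains_diff[OF w(1) free.koszul_in_chains[OF y(1)]])
  moreover have "koszul fscale v G = z G" for G
    unfolding v_def by (simp add: free.koszul_diff free.koszul_koszul w(2))
  moreover have "in_kernel (Suc c) (v G)" for G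
    using koszul_d[of c y G] by (simp add: in_kernel_def v_def d.diff uy u(2))
  ultimately show ?case by blast
qed

end

text \<open>For k = 0 there are too few variables for a nonzero chain. For k = \<open>Suc l\<close>
  the chain is moved into F_l along the isomorphism, and the preimage found there is moved
  back.\<close>

lemma koszul_exact_of_syzygy:
  fixes scaleM :: "('n::finite, 'k::field) mpoly \<Rightarrow> 'm::ab_group_add \<Rightarrow> 'm"
    and scaleN :: "('n, 'k) mpoly \<Rightarrow> 'b::ab_group_add \<Rightarrow> 'b"
  assumes M: "graded_family scaleM grM" and syz: "is_syzygy_of k scaleM grM scaleN grN"
    and z: "z \<in> koszul_chains grM V (Suc q) a" and cycle: "\<And>G. koszul scaleM z G = 0"
    and V: "card V < Suc q + k"
  shows "\<exists>y\<in>koszul_chains grM V (Suc (Suc q)) a. \<forall>G. z G = koszul scaleM y G"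
proof -
  interpret M: graded_family scaleM grM by fact
  obtain D d e where res: "minimal_graded_free_resolution scaleN grN D d e"
    and iso: "case k of 0 \<Rightarrow> graded_iso_onto scaleM grM scaleN UNIV grN
         | Suc l \<Rightarrow> graded_iso_onto scaleM grM fscale (d l ` free_mod (D (Suc l))) (free_gr (D l))"
    using syz unfolding is_syzygy_of_def by blast
  interpret free_resolution scaleN grN D d e
    using res by unfold_locales (simp add: minimal_graded_free_resolution_def)
  show ?thesis
  proof (cases k)
    case 0
    have "z G = 0" for G
    proof (rule ccontr)
      assume "z G \<noteq> 0"
      then have "G \<subseteq> V" "card G = Suc q" using koszul_chainsD(2,3)[OF z] by blast+
      then show False using V 0 card_mono[of V G] by simp
    qed
    then show ?thesis using M.chains_zero M.koszul_zero by (intro bexI[of _ "\<lambda>G. 0"]) auto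
  next
    case (Suc l)
    define X :: "('n, 'k) fvec set" where "X = d l ` free_mod (D (Suc l))"
    obtain \<phi> where hom: "module_hom scaleM fscale \<phi>" and bij: "bij_betw \<phi> UNIV X"
      and gr: "\<And>a. \<phi> ` grM a = X \<inter> free_gr (D l) a"
      using iso unfolding Suc graded_iso_onto_def X_def by auto
    interpret \<phi>: module_hom scaleM fscale \<phi> by fact
    have "(\<lambda>G. \<phi> (z G)) \<in> K l V (Suc q) a"
      by (rule chains_hom[OF hom _ z]) (simp add: gr)
    moreover have "koszul fscale (\<lambda>G. \<phi> (z G)) G = 0" for G
      using cycle by (simp add: koszul_hom[OF hom] \<phi>.zero)
    moreover have "in_kernel l (\<phi> (z G))" for G
    proof -
      have "\<phi> (z G) \<in> X \<inter> free_gr (D l) (sub_deg a G)"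
        using koszul_chainsD(1)[OF z] gr by blast
      then show ?thesis
        using in_kernel_iff subsetD[OF free_gr_subset_free_mod] unfolding X_def by blast
    qed
    \<comment> \<open>M is the syzygy module of index l + 1, so the strict bound with k becomes the
      weak bound with l.\<close>
    moreover have "card V \<le> Suc q + l" using V Suc by simp
    ultimately obtain w where w: "w \<in> K l V (Suc (Suc q)) a"
        "\<And>G. koszul fscale w G = \<phi> (z G)" "\<And>G. in_kernel l (w G)"
      using koszul_syzygy_exact[of "\<lambda>G. \<phi> (z G)" l V q a] by blast
    have "w G \<in> X" for G
      using in_kernel_iff[OF chain_free_mod[OF w(1)]] w(3) by (simp add: X_def)
    then have "\<exists>y\<in>grM b. \<phi> y = w G" if "w G \<in> free_gr (D l) b" for G b
      using gr[of b] that by (metis IntI imageE)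
    from chains_lift[OF M hom w(1) this] obtain y
      where y: "y \<in> koszul_chains grM V (Suc (Suc q)) a" "\<And>G. \<phi> (y G) = w G" by metis
    have "(\<lambda>G. \<phi> (y G)) = w" using y(2) by auto
    then have "\<phi> (koszul scaleM y G) = \<phi> (z G)" for G
      using koszul_hom[OF hom, of y G] by (simp add: w(2))
    then have "z G = koszul scaleM y G" for G
      using bij_betw_imp_inj_on[OF bij] by (metis injD)
    then show ?thesis using y(1) by blast
  qed
qed

section \<open>Free resolutions of syzygy modules\<close>

definition restrict_free :: "('n \<Rightarrow> int) list \<Rightarrow> ('n, 'k::field) fvec \<Rightarrow> ('n, 'k) fvec" where
  "restrict_free E = Poly_Mapping.mapp (\<lambda>r q. if r < length E then q else 0)"

lemma lookup_restrict_free: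
  "Poly_Mapping.lookup (restrict_free E v) r = (if r < length E then Poly_Mapping.lookup v r else 0)"
  by (auto simp: restrict_free_def lookup_mapp when_def in_keys_iff)

lemma restrict_free_in: "restrict_free E v \<in> free_mod E"
  by (simp add: free_mod_iff lookup_restrict_free)

lemma restrict_free_id: "v \<in> free_mod E \<Longrightarrow> restrict_free E v = v"
  by (rule poly_mapping_eqI) (simp add: free_mod_iff lookup_restrict_free)

text \<open>\<open>f\<close> is known to have values in the range of \<open>\<phi>\<close> on
  \<open>free_mod E\<close>, while \<open>g\<close> must be given on the whole ambient module; so
  the projection \<open>restrict_free E\<close> is applied before \<open>f\<close>.\<close>

lemma pull_back_hom:
  fixes scale1 :: "('n, 'k::field) mpoly \<Rightarrow> 'm::ab_group_add \<Rightarrow> 'm"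
  assumes \<phi>: "module_hom scale1 scale2 \<phi>" "inj \<phi>" and f: "module_hom fscale scale2 f"
    and range: "f ` free_mod E \<subseteq> range \<phi>"
  obtains g where "module_hom fscale scale1 g" "\<And>v. v \<in> free_mod E \<Longrightarrow> \<phi> (g v) = f v"
proof -
  interpret \<phi>: module_hom scale1 scale2 \<phi> by fact
  interpret f: module_hom fscale scale2 f by fact
  define g where "g = (\<lambda>v. inv \<phi> (f (restrict_free E v)))"
  have g: "\<phi> (g v) = f (restrict_free E v)" for v
    unfolding g_def by (rule f_inv_into_f) (use range restrict_free_in in blast)
  have radd: "restrict_free E (x + y) = restrict_free E x + restrict_free E y" for x y :: "('n, 'k) fvec"
    by (rule poly_mapping_eqI) (simp add: lookup_restrict_free lookup_add)
  have rscale: "restrict_free E (fscale c x) = fscale c (restrict_free E x)" for c and x :: "('n, 'k) fvec"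
    by (rule poly_mapping_eqI) (simp add: lookup_restrict_free lookup_fscale)
  show ?thesis
  proof (rule that)
    show "module_hom fscale scale1 g"
    proof unfold_locales
      show "g (x + y) = g x + g y" for x y
        by (rule injD[OF \<phi>(2)]) (simp only: \<phi>.add g radd f.add)
      show "g (fscale c x) = scale1 c (g x)" for c x
        by (rule injD[OF \<phi>(2)]) (simp only: \<phi>.scale g rscale f.scale)
    qed
    show "\<phi> (g v) = f v" if "v \<in> free_mod E" for v using restrict_free_id[OF that] by (simp add: g)
  qed
qed

text \<open>The tail of the given resolution resolves the syzygy module.\<close>

lemma syzygy_resolution:
  fixes scaleM :: "('n::finite, 'k::field) mpoly \<Rightarrow> 'm::ab_group_add \<Rightarrow> 'm"
    and scaleN :: "('n, 'k) mpoly \<Rightarrow> 'b::ab_group_add \<Rightarrow> 'b"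
  assumes syz: "is_syzygy_of k scaleM grM scaleN grN"
  shows "\<exists>D d e. graded_free_resolution scaleM grM D d e"
proof -
  obtain D d e where res: "minimal_graded_free_resolution scaleN grN D d e"
    and iso: "case k of 0 \<Rightarrow> graded_iso_onto scaleM grM scaleN UNIV grN
         | Suc l \<Rightarrow> graded_iso_onto scaleM grM fscale (d l ` free_mod (D (Suc l))) (free_gr (D l))"
    using syz unfolding is_syzygy_of_def by blast
  interpret free_resolution scaleN grN D d e
    using res by unfold_locales (simp add: minimal_graded_free_resolution_def)
  show ?thesis
  proof (cases k)
    case 0
    obtain \<phi> where hom: "module_hom scaleM scaleN \<phi>" and bij: "bij \<phi>" and gr: "\<And>a. \<phi> ` grM a = grN a"
      using iso unfolding 0 graded_iso_onto_def by auto
    interpret \<phi>: module_hom scaleM scaleN \<phi> by fact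
    have inj: "inj \<phi>" using bij by (rule bij_is_inj)
    obtain g where g: "module_hom fscale scaleM g" "\<And>v. v \<in> free_mod (D 0) \<Longrightarrow> \<phi> (g v) = e v"
      using pull_back_hom[OF hom inj e_hom, of "D 0"] bij_is_surj[OF bij] by blast
    have zero: "g v = 0 \<longleftrightarrow> e v = 0" if "v \<in> free_mod (D 0)" for v
      using g(2)[OF that] inj \<phi>.zero by (metis injD)
    have "graded_free_resolution scaleM grM D d g"
      unfolding graded_free_resolution_def
    proof (intro conjI allI)
      show "g ` free_gr (D 0) a \<subseteq> grM a" for a
      proof clarify
        fix v :: "('n, 'k) fvec" assume v: "v \<in> free_gr (D 0) a"
        have "\<phi> (g v) \<in> \<phi> ` grM a"
          unfolding gr using g(2)[OF subsetD[OF free_gr_subset_free_mod v]] e_gr v by auto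
        then show "g v \<in> grM a" using inj by (simp add: inj_image_mem_iff)
      qed
      show "g ` free_mod (D 0) = UNIV"
      proof (rule UNIV_eq_I[symmetric])
        fix x
        obtain v where "v \<in> free_mod (D 0)" "e v = \<phi> x" using e_onto by (metis UNIV_I imageE)
        then show "x \<in> g ` free_mod (D 0)" using g(2) inj by (metis injD imageI)
      qed
      show "d 0 ` free_mod (D (Suc 0)) = {v \<in> free_mod (D 0). g v = 0}"
        unfolding exact_0 using zero by blast
    qed (use g(1) d_hom d_gr exact_Suc in simp_all)
    then show ?thesis by blast
  next
    case (Suc l)
    obtain \<phi> where hom: "module_hom scaleM fscale \<phi>" and bij: "bij_betw \<phi> UNIV (d l ` free_mod (D (Suc l)))"
      and gr: "\<And>a. \<phi> ` grM a = d l ` free_mod (D (Suc l)) \<inter> free_gr (D l) a"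
      using iso unfolding Suc graded_iso_onto_def by auto
    interpret \<phi>: module_hom scaleM fscale \<phi> by fact
    have inj: "inj \<phi>" and range: "range \<phi> = d l ` free_mod (D (Suc l))"
      using bij by (auto simp: bij_betw_def)
    obtain g where g: "module_hom fscale scaleM g" "\<And>v. v \<in> free_mod (D (Suc l)) \<Longrightarrow> \<phi> (g v) = d l v"
      using pull_back_hom[OF hom inj d_hom, of l "D (Suc l)"] range by blast
    have zero: "g v = 0 \<longleftrightarrow> d l v = 0" if "v \<in> free_mod (D (Suc l))" for v
      using g(2)[OF that] inj \<phi>.zero by (metis injD)
    have "graded_free_resolution scaleM grM (\<lambda>i. D (Suc l + i)) (\<lambda>i. d (Suc l + i)) g"
      unfolding graded_free_resolution_def
    proof (intro conjI allI)
      show "g ` free_gr (D (Suc l + 0)) a \<subseteq> grM a" for a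
      proof clarify
        fix v :: "('n, 'k) fvec" assume v: "v \<in> free_gr (D (Suc l + 0)) a"
        then have "v \<in> free_mod (D (Suc l))" using subsetD[OF free_gr_subset_free_mod] by auto
        then have "\<phi> (g v) \<in> \<phi> ` grM a"
          unfolding gr using g(2) d_gr[of l a] v by auto
        then show "g v \<in> grM a" using inj by (simp add: inj_image_mem_iff)
      qed
      show "g ` free_mod (D (Suc l + 0)) = UNIV"
      proof (rule UNIV_eq_I[symmetric])
        fix x
        obtain v where "v \<in> free_mod (D (Suc l))" "d l v = \<phi> x" using range by (metis rangeI imageE)
        then show "x \<in> g ` free_mod (D (Suc l + 0))" using g(2) inj by (metis injD imageI add_0_right)
      qed
      have "{v \<in> free_mod (D (Suc l)). g v = 0} = {v \<in> free_mod (D (Suc l)). d l v = 0}"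
        using zero by blast
      then show "d (Suc l + 0) ` free_mod (D (Suc l + Suc 0)) = {v \<in> free_mod (D (Suc l + 0)). g v = 0}"
        using exact_Suc[of l] by simp
    next
      fix i show "d (Suc l + Suc i) ` free_mod (D (Suc l + Suc (Suc i))) =
          {v \<in> free_mod (D (Suc l + Suc i)). d (Suc l + i) v = 0}"
        using exact_Suc[of "Suc l + i"] by simp
    next
      fix i a show "d (Suc l + i) ` free_gr (D (Suc l + Suc i)) a \<subseteq> free_gr (D (Suc l + i)) a"
        using d_gr[of "Suc l + i" a] by simp
    qed (use g(1) d_hom in simp_all)
    then show ?thesis by blast
  qed
qed

section \<open>Contractions and counting\<close>

context graded_family
begin

text \<open>The interior product with the dual of the j-th exterior generator.\<close>

definition contract :: "'n \<Rightarrow> ('n set \<Rightarrow> 'm) \<Rightarrow> 'n set \<Rightarrow> 'm" where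
  "contract j z G = (if j \<in> G then 0 else scale (const (koszul_sign j G)) (z (insert j G)))"

lemma contract_nonzero_iff: "contract j z G \<noteq> 0 \<longleftrightarrow> j \<notin> G \<and> z (insert j G) \<noteq> 0"
proof -
  have "scale (const (koszul_sign j G)) (scale (const (koszul_sign j G)) x) = x" for x
    by (simp add: const_mult)
  then have "scale (const (koszul_sign j G)) x = 0 \<longleftrightarrow> x = 0" for x by (metis scale_zero_right)
  then show ?thesis by (simp add: contract_def)
qed

lemma contract_in_chains:
  assumes z: "z \<in> koszul_chains gr V (Suc p) a"
  shows "contract j z \<in> koszul_chains gr V p (sub_deg a {j})"
proof (rule koszul_chainsI)
  show "contract j z G \<in> gr (sub_deg (sub_deg a {j}) G)" for G
    using gr_const[OF koszul_chainsD(1)[OF z, of "insert j G"]] sub_deg_union[of G "{j}" a]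
    by (auto simp: contract_def gr_zero)
  show "G \<subseteq> V \<and> card G = p" if "contract j z G \<noteq> 0" for G
  proof -
    have "j \<notin> G" "z (insert j G) \<noteq> 0" using that by (simp_all add: contract_nonzero_iff)
    then show ?thesis using koszul_chainsD(2,3)[OF z, of "insert j G"] by auto
  qed
qed

text \<open>Contraction anticommutes with the differential by \<open>koszul_sign_swap\<close>; the
  summand i = j drops out because a contraction vanishes on sets containing j.\<close>

lemma koszul_contract:
  assumes "\<And>G. koszul scale z G = 0"
  shows "koszul scale (contract j z) G = 0"
proof (cases "j \<in> G")
  case True
  then show ?thesis by (simp add: koszul_def contract_def)
next
  case False
  have "koszul scale (contract j z) G =
      (\<Sum>i\<in>- insert j G. scale (linear_term i (koszul_sign i G)) (contract j z (insert i G)))"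
    unfolding koszul_def by (rule sum.mono_neutral_right) (auto simp: contract_def)
  also have "\<dots> = (\<Sum>i\<in>- insert j G. - scale (const (koszul_sign j G))
      (scale (linear_term i (koszul_sign i (insert j G))) (z (insert i (insert j G)))))"
  proof (rule sum.cong)
    fix i assume "i \<in> - insert j G"
    then have ij: "i \<noteq> j" "i \<notin> G" by auto
    have "linear_term i (koszul_sign i G) * const (koszul_sign j (insert i G)) =
        - (const (koszul_sign j G) * linear_term i (koszul_sign i (insert j G)) :: ('n, 'k) mpoly)"
      using koszul_sign_swap[OF ij False, where ?'b = 'k]
      by (simp add: const_times_linear_term mult.commute[of "linear_term i _"] single_uminus
          mult.commute[of "koszul_sign j (insert i G)"] del: One_nat_def)
    then show "scale (linear_term i (koszul_sign i G)) (contract j z (insert i G)) =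
        - scale (const (koszul_sign j G)) (scale (linear_term i (koszul_sign i (insert j G))) (z (insert
            i (insert j G))))"
      using ij False by (simp add: contract_def insert_commute[of j i] del: One_nat_def flip: scale_minus_left)
  qed simp
  also have "\<dots> = - scale (const (koszul_sign j G)) (koszul scale z (insert j G))"
    by (simp only: koszul_def scale_sum_right sum_negf)
  finally show ?thesis by (simp add: assms)
qed

text \<open>The elements of T are contracted one after another. Their order affects only signs, so
  just the support of the result is recorded.\<close>

lemma exists_contraction:
  fixes T :: "'n set"
  assumes z: "z \<in> koszul_chains gr UNIV p a" "\<And>G. koszul scale z G = 0" and "card T \<le> p"
  shows "\<exists>y\<in>koszul_chains gr UNIV (p - card T) (sub_deg a T). (\<forall>G. koszul scale y G = 0) \<and>
    (\<forall>G. y G \<noteq> 0 \<longleftrightarrow> G \<inter> T = {} \<and> z (G \<union> T) \<noteq> 0)"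
  using finite_class.finite[of T] assms(3)
proof (induction T rule: finite_induct)
  case empty
  then show ?case using z by auto
next
  case (insert j T)
  then obtain y where y: "y \<in> koszul_chains gr UNIV (p - card T) (sub_deg a T)" "\<And>G. koszul scale y G = 0"
    "\<And>G. y G \<noteq> 0 \<longleftrightarrow> G \<inter> T = {} \<and> z (G \<union> T) \<noteq> 0" by auto
  have p: "p - card T = Suc (p - card (insert j T))" using insert.hyps insert.prems by simp
  have "sub_deg (sub_deg a T) {j} = sub_deg a (insert j T)"
    using sub_deg_union[of "{j}" T a] insert.hyps by simp
  then have "contract j y \<in> koszul_chains gr UNIV (p - card (insert j T)) (sub_deg a (insert j T))"
    using contract_in_chains[of y UNIV "p - card (insert j T)" "sub_deg a T" j] y(1) p by simp
  moreover have "koszul scale (contract j y) G = 0" for G using koszul_contract y(2) by blast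
  moreover have "contract j y G \<noteq> 0 \<longleftrightarrow> G \<inter> insert j T = {} \<and> z (G \<union> insert j T) \<noteq> 0" for G
    unfolding contract_nonzero_iff y(3) using insert.hyps by auto
  ultimately show ?case by blast
qed

end

section \<open>Counting the faces of a simplicial complex\<close>

lemma Suc_times_binomial_Suc: "Suc s * (m choose Suc s) = (m - s) * (m choose s)"
  by (simp only: binomial_absorption binomial_absorb_comp)

text \<open>Counts the pairs of a face T with s elements and a vertex j of its link. Each T has at
  least m - s such j, and each face with s + 1 elements arises s + 1 times; binomial coefficients
  satisfy the same recursion with equality.\<close>

lemma card_faces_ge_binomial:
  fixes F :: "'n::finite set set"
  assumes "{} \<in> F" and down: "\<And>T j. T \<in> F \<Longrightarrow> j \<in> T \<Longrightarrow> T - {j} \<in> F"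
    and link: "\<And>T. T \<in> F \<Longrightarrow> card T < p \<Longrightarrow> m - card T \<le> card {j. j \<notin> T \<and> insert j T \<in> F}"
    and "s \<le> p"
  shows "m choose s \<le> card {T \<in> F. card T = s}"
  using assms(4)
proof (induction s)
  case 0
  have "{T \<in> F. card T = 0} = {{}}" using assms(1) by auto
  then show ?case by simp
next
  case (Suc s)
  let ?F = "\<lambda>s. {T \<in> F. card T = s}"
  let ?L = "\<lambda>T. {j. j \<notin> T \<and> insert j T \<in> F}"
  have "Suc s * (m choose Suc s) = (m - s) * (m choose s)" by (rule Suc_times_binomial_Suc)
  also have "\<dots> \<le> (m - s) * card (?F s)" using Suc by simp
  also have "\<dots> = (\<Sum>T\<in>?F s. m - s)" by simp
  also have "\<dots> \<le> (\<Sum>T\<in>?F s. card (?L T))"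
    by (rule sum_mono) (use link Suc.prems in auto)
  also have "\<dots> = card (Sigma (?F s) ?L)" by simp
  also have "\<dots> \<le> card (Sigma (?F (Suc s)) (\<lambda>T. T))"
  proof (rule card_inj_on_le)
    show "inj_on (\<lambda>(T, j). (insert j T, j)) (Sigma (?F s) ?L)"
      by (rule inj_onI) (auto dest: insert_ident[THEN iffD1, rotated 2])
    show "(\<lambda>(T, j). (insert j T, j)) ` Sigma (?F s) ?L \<subseteq> Sigma (?F (Suc s)) (\<lambda>T. T)"
      by auto
  qed simp
  also have "\<dots> = (\<Sum>T\<in>?F (Suc s). card T)" by simp
  also have "\<dots> = card (?F (Suc s)) * Suc s" by simp
  finally have "Suc s * (m choose Suc s) \<le> Suc s * card (?F (Suc s))" by (simp only: mult.commute)
  then show ?case by (simp only: Suc_mult_le_cancel1)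
qed

section \<open>The linear strand\<close>

context module_resolution
begin

lemma coarse_trivial_iff: "coarse gr i = {0} \<longleftrightarrow> (\<forall>c. total c = i \<longrightarrow> gr c = {0})"
proof
  assume triv: "coarse gr i = {0}"
  show "\<forall>c. total c = i \<longrightarrow> gr c = {0}"
  proof (intro allI impI)
    fix c :: "'n \<Rightarrow> int" assume c: "total c = i"
    have "x \<in> coarse gr i" if "x \<in> gr c" for x
      unfolding coarse_def using that c gr_zero
      by (intro CollectI exI[of _ "Poly_Mapping.single c x"]) (auto simp: lookup_single when_def)
    then show "gr c = {0}" using triv gr_zero by blast
  qed
next
  assume triv: "\<forall>c. total c = i \<longrightarrow> gr c = {0}"
  have "x = 0" if "x \<in> coarse gr i" for x
  proof -
    obtain f where f: "x = (\<Sum>a\<in>Poly_Mapping.keys f. Poly_Mapping.lookup f a)"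
        "\<And>a. Poly_Mapping.lookup f a \<in> gr a"
      "\<And>a. a \<in> Poly_Mapping.keys f \<Longrightarrow> total a = i"
      using \<open>x \<in> coarse gr i\<close> unfolding coarse_def by blast
    have "Poly_Mapping.lookup f a = 0" if "a \<in> Poly_Mapping.keys f" for a
      using f(2)[of a] f(3)[OF that] triv by blast
    then show "x = 0" unfolding f(1) by (rule sum.neutral[OF ballI])
  qed
  moreover have "0 \<in> coarse gr i"
    unfolding coarse_def using gr_zero by (intro CollectI exI[of _ 0]) auto
  ultimately show "coarse gr i = {0}" by blast
qed

text \<open>A homogeneous preimage in F_0 contains a monomial, and monomials only raise the degree
  of a basis element.\<close>

lemma degree_bounded_below:
  assumes "x \<in> gr c" "x \<noteq> 0"
  shows "Min (total ` set (D 0)) \<le> total c"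
proof -
  obtain v where v: "v \<in> free_gr (D 0) c" "e v = x" using lift_e assms(1) by blast
  then have "v \<noteq> 0" using assms(2) e.zero by blast
  then obtain r t where rt: "Poly_Mapping.lookup (Poly_Mapping.lookup v r) t \<noteq> 0"
    using fvec_eqI[of v 0] by auto
  then have r: "r < length (D 0)" using v(1) by (metis free_gr_iff leI lookup_zero)
  have "shift t (D 0 ! r) = c" using v(1) r rt by (simp add: free_gr_iff in_keys_iff)
  then have "total c = (\<Sum>l\<in>UNIV. int (Poly_Mapping.lookup t l)) + total (D 0 ! r)"
    by (auto simp: total_def shift_def sum.distrib)
  moreover have "(\<Sum>l\<in>UNIV. int (Poly_Mapping.lookup t l)) \<ge> 0" by (rule sum_nonneg) simp
  moreover have "Min (total ` set (D 0)) \<le> total (D 0 ! r)" using r by (intro Min_le) auto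
  ultimately show ?thesis by simp
qed

text \<open>\<open>initial_degree\<close> is a definite description, so a least degree must be
  exhibited: x shows that some component is nonzero, and the basis degrees of F_0 give a lower
  bound.\<close>

lemma zero_below_initial_degree:
  assumes x: "x \<in> gr a" "x \<noteq> 0" and c: "total c < initial_degree gr"
  shows "gr c = {0}"
proof -
  define m where "m = Min (total ` set (D 0))"
  have low: "m \<le> i" if "coarse gr i \<noteq> {0}" for i
    using that degree_bounded_below gr_zero unfolding coarse_trivial_iff m_def by blast
  have nz: "coarse gr (total a) \<noteq> {0}" using x coarse_trivial_iff by blast
  \<comment> \<open>Subtracting the lower bound m turns the relevant degrees into natural numbers,
    which have a least element.\<close>
  obtain d0 where d0: "coarse gr d0 \<noteq> {0}" and min: "\<And>i. coarse gr i \<noteq> {0} \<Longrightarrow> nat (d0 - m) \<le> nat (i - m)"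
    using ex_has_least_nat[of "\<lambda>i. coarse gr i \<noteq> {0}" _ "\<lambda>i. nat (i - m)"] nz by blast
  have least: "d0 \<le> i" if "coarse gr i \<noteq> {0}" for i
    using min[OF that] low[OF that] low[OF d0] by simp
  have "initial_degree gr = d0"
    unfolding initial_degree_def
  proof (rule the_equality)
    show "(\<forall>i<d0. coarse gr i = {0}) \<and> coarse gr d0 \<noteq> {0}" using least d0 by (meson leD)
    show "d' = d0" if "(\<forall>i<d'. coarse gr i = {0}) \<and> coarse gr d' \<noteq> {0}" for d'
      using that least[of d'] d0 by (meson leD antisym_conv not_le)
  qed
  then have "coarse gr (total c) = {0}" using c least by (meson leD)
  then show ?thesis using coarse_trivial_iff by blast
qed

end

theorem corollary3p4:
  fixes scaleM :: "('n::finite, 'k::field) mpoly \<Rightarrow> 'm::ab_group_add \<Rightarrow> 'm"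
    and grM :: "('n \<Rightarrow> int) \<Rightarrow> 'm set"
    and scaleN :: "('n, 'k) mpoly \<Rightarrow> 'b::ab_group_add \<Rightarrow> 'b"
    and grN :: "('n \<Rightarrow> int) \<Rightarrow> 'b set"
    and k p :: nat
  assumes "zn_graded_module scaleM grM"
    and "finitely_generated scaleM"
    and "zn_graded_module scaleN grN"
    and "finitely_generated scaleN"
    and "is_syzygy_of k scaleM grM scaleN grN"
    and "betti_lin scaleM grM p \<noteq> 0"
  shows "\<forall>i\<le>p. betti_lin scaleM grM i \<ge> (p + k) choose (i + k)"
proof (intro allI impI)
  fix i assume ip: "i \<le> p"
  \<comment> \<open>Literally the choice made inside \<open>betti\<close>. It does not depend on the
    homological degree, so one resolution serves p and every i.\<close>
  define R where "R = (SOME (D, d). \<exists>e. graded_free_resolution scaleM grM D d e)"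
  obtain D d where R: "R = (D, d)" by force
  have "\<exists>R. case R of (D, d) \<Rightarrow> \<exists>e. graded_free_resolution scaleM grM D d e"
    using syzygy_resolution[OF assms(5)] by auto
  then have "case R of (D, d) \<Rightarrow> \<exists>e. graded_free_resolution scaleM grM D d e"
    unfolding R_def by (rule someI_ex)
  then obtain e where e: "graded_free_resolution scaleM grM D d e" using R by auto
  interpret M: zn_graded_module scaleM grM by (rule assms(1))
  interpret module_resolution scaleM grM D d e
    by unfold_locales (rule e)
  define d0 where "d0 = initial_degree grM"
  have betti: "betti_lin scaleM grM q = tor_dim D d q (int q + d0)" for q
    unfolding betti_lin_def betti_def d0_def using R by (simp add: R_def)
  obtain a v where a: "total a = int p + d0" and v: "v \<in> free_gr (D p) a"
      "v \<in> tor_cycles D d p (int p + d0)" "v \<notin> tor_boundaries D d p (int p + d0)"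
    using tor_dim_nonzero assms(6) unfolding betti by metis
  obtain z where z: "koszul_cycle p a z" "\<not> koszul_boundary p a z"
    using tor_nonzero_iff_koszul[OF a] v by blast
  have zc: "z \<in> koszul_chains grM UNIV p a" "\<And>G. koszul scaleM z G = 0"
    using z(1) by (auto simp: koszul_cycle_def)
  obtain G0 where G0: "z G0 \<noteq> 0"
    using z(2) chains_zero koszul_zero unfolding koszul_boundary_def by metis
  have below: "grM c = {0}" if "total c < d0" for c
    using zero_below_initial_degree[OF koszul_chainsD(1)[OF zc(1)] G0] that by (simp add: d0_def)
  \<comment> \<open>The coefficients of y have total degree q + d0 - (q + 1) = d0 - 1, where M
    vanishes.\<close>
  have no_boundary: "koszul scaleM y G = 0"
    if y: "y \<in> koszul_chains grM V (Suc q) c" and c: "total c = int q + d0" for y V q c G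
  proof -
    have "y H = 0" for H
    proof (rule ccontr)
      assume "y H \<noteq> 0"
      then have "card H = Suc q" using koszul_chainsD(3)[OF y] by blast
      then have "total (sub_deg c H) < d0" by (simp add: total_sub_deg c)
      then show False using koszul_chainsD(1)[OF y, of H] below \<open>y H \<noteq> 0\<close> by blast
    qed
    then show ?thesis by (simp add: koszul_def)
  qed
  define F where "F = {T. \<exists>G. T \<subseteq> G \<and> z G \<noteq> 0}"
  have card_le: "card T \<le> p" if T: "T \<in> F" for T
  proof -
    obtain G where "T \<subseteq> G" "z G \<noteq> 0" using T by (auto simp: F_def)
    then show ?thesis using koszul_chainsD(3)[OF zc(1), of G] card_mono[of G T] by simp
  qed
  have face: "\<exists>y\<in>koszul_chains grM UNIV (p - card T) (sub_deg a T). (\<forall>G. koszul scaleM y G = 0) \<and>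
      (\<exists>G. y G \<noteq> 0) \<and> (\<forall>G. y G \<noteq> 0 \<longrightarrow> G \<inter> T = {} \<and> z (G \<union> T) \<noteq> 0)" if T: "T \<in> F" for T
  proof -
    obtain y where y: "y \<in> koszul_chains grM UNIV (p - card T) (sub_deg a T)" "\<forall>G. koszul scaleM y G = 0"
        "\<forall>G. y G \<noteq> 0 \<longleftrightarrow> G \<inter> T = {} \<and> z (G \<union> T) \<noteq> 0"
      using exists_contraction[OF zc card_le[OF T]] by blast
    obtain G where G: "T \<subseteq> G" "z G \<noteq> 0" using T by (auto simp: F_def)
    have "(G - T) \<union> T = G" using G(1) by blast
    then have "y (G - T) \<noteq> 0" using y(3) G(2) by (metis Diff_disjoint inf_commute)
    then show ?thesis using y by blast
  qed
  have "(p + k) choose (p - i) \<le> card {T \<in> F. card T = p - i}"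
  proof (rule card_faces_ge_binomial)
    show "{} \<in> F" using G0 by (auto simp: F_def)
    show "T - {j} \<in> F" if "T \<in> F" for T j using that by (auto simp: F_def)
    show "p - i \<le> p" by simp
    fix T assume T: "T \<in> F" and small: "card T < p"
    \<comment> \<open>The vertices of the link of T. The contraction y of z along T involves only
      these variables.\<close>
    define V where "V = {j. j \<notin> T \<and> insert j T \<in> F}"
    obtain y where y: "y \<in> koszul_chains grM UNIV (p - card T) (sub_deg a T)" "\<And>G. koszul scaleM y G = 0"
        "\<exists>G. y G \<noteq> 0" "\<And>G. y G \<noteq> 0 \<Longrightarrow> G \<inter> T = {} \<and> z (G \<union> T) \<noteq> 0"
      using face[OF T] by blast
    \<comment> \<open>Since T has fewer than p elements, y has positive homological degree, as the
      vanishing for syzygy modules requires.\<close>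
    obtain q where q: "p - card T = Suc q" using small by (metis Suc_diff_Suc)
    have yV: "y \<in> koszul_chains grM V (Suc q) (sub_deg a T)"
    proof (rule koszul_chainsI)
      show "y G \<in> grM (sub_deg (sub_deg a T) G)" for G by (rule koszul_chainsD(1)[OF y(1)])
      show "G \<subseteq> V \<and> card G = Suc q" if "y G \<noteq> 0" for G
      proof
        show "card G = Suc q" using koszul_chainsD(3)[OF y(1) that] q by simp
        have "j \<notin> T \<and> insert j T \<subseteq> G \<union> T" if "j \<in> G" for j using y(4)[OF \<open>y G \<noteq> 0\<close>] that by blast
        then show "G \<subseteq> V" using y(4)[OF that] unfolding V_def F_def by blast
      qed
    qed
    show "p + k - card T \<le> card {j. j \<notin> T \<and> insert j T \<in> F}"
    proof (rule ccontr)
      assume "\<not> ?thesis"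
      \<comment> \<open>\<open>p + k - card T\<close> equals \<open>Suc q + k\<close>. With fewer
        variables y would be a Koszul boundary, hence zero by \<open>no_boundary\<close>.\<close>
      then have "card V < Suc q + k" using q by (simp add: V_def)
      then obtain x where x: "x \<in> koszul_chains grM V (Suc (Suc q)) (sub_deg a T)" "\<And>G. y G = koszul scaleM x G"
        using koszul_exact_of_syzygy[OF M.graded_family assms(5) yV y(2)] by blast
      have "total (sub_deg a T) = int (Suc q) + d0" using q a by (simp add: total_sub_deg)
      then show False using no_boundary[OF x(1)] x(2) y(3) by simp
    qed
  qed
  also have "\<dots> = card (sub_deg a ` {T \<in> F. card T = p - i})"
    by (rule card_image[symmetric]) (rule inj_on_subset[OF inj_sub_deg subset_UNIV])
  also have "\<dots> \<le> tor_dim D d i (int i + d0)"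
  proof (rule card_le_tor_dim)
    fix c assume "c \<in> sub_deg a ` {T \<in> F. card T = p - i}"
    then obtain T where T: "T \<in> F" "card T = p - i" "c = sub_deg a T" by blast
    show c: "total c = int i + d0" using T(2) ip a by (simp add: T(3) total_sub_deg of_nat_diff)
    obtain y where y: "y \<in> koszul_chains grM UNIV (p - card T) c" "\<And>G. koszul scaleM y G = 0" "\<exists>G. y G \<noteq> 0"
      using face[OF T(1)] T(3) by blast
    have "p - card T = i" using T(2) ip by simp
    then have "koszul_cycle i c y" using y by (simp add: koszul_cycle_def)
    moreover have "\<not> koszul_boundary i c y"
      using no_boundary[OF _ c] y(3) unfolding koszul_boundary_def by metis
    ultimately show "\<exists>v\<in>free_gr (D i) c. v \<in> tor_cycles D d i (int i + d0) \<and> v \<notin> tor_boundaries D d i (int i + d0)"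
      using tor_nonzero_iff_koszul[OF c] by blast
  qed simp
  finally have "(p + k) choose (p - i) \<le> betti_lin scaleM grM i" by (simp add: betti)
  moreover have "(p + k) choose (i + k) = (p + k) choose (p - i)"
    using binomial_symmetric[of "i + k" "p + k"] ip by simp
  ultimately show "(p + k) choose (i + k) \<le> betti_lin scaleM grM i" by simp
qed

end
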